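(* Let $P$ be a propositional proof system that simulates Extended Frege EF and such that for some constant $c\ge1$: (i) whenever $\sigma\in$ TAUT and $\sigma'$ is obtained from $\sigma$ by substituting constants $0$ or $1$ for some atoms, $s_P(\sigma')\le s_P(\sigma)^c$; and (ii) for all formulas $\alpha,\beta$, $s_P(\beta)\le(s_P(\alpha)+s_P(\alpha\to\beta))^c$. Assume $P$ admits a proof complexity generator that is $\bigvee$-hard for $P$ and is computed in non-uniform polynomial time (i.e. by polynomial-size circuits). Then the gadget generator $\mathrm{Gad}_f$ based on $f=CV_{k^2,k}$ is $\bigvee$-hard for $P$.
   Context: A propositional proof system (pps) is a polynomial-time relation $P(x,y)$ with $\exists xP(x,y)$ iff $y\in$ TAUT; $s_P(\tau)$ is the minimal size of a $P$-proof of $\tau$; $P$ simulates $Q$ iff there is $c$ with $s_P(\sigma)\le s_Q(\sigma)^c$ for all tautologies $\sigma$. A proof complexity generator is a function $g$ stretching size-$n$ inputs to size $m=m(n)>n$ whose restriction $g_n$ is computed by a circuit $C_n$ of size $m^{O(1)}$; for $b\in\{0,1\}^m$, $\tau(g_n)_b$ is the natural size-$m^{O(1)}$ propositional encoding of "$|x|=n\to C_n(x)\neq b$". $g$ is $\bigvee$-hard for $P$ if for every $c\ge1$ only finitely many disjunctions $\tau(g_n)_{b_1}\vee\dots\vee\tau(g_n)_{b_r}$ ($n,r\ge1$, $b_i\in\{0,1\}^m$, disjuncts in disjoint atoms) have $P$-proofs of size $\le m^c$. Gadget generator: for a p-time $f:\{0,1\}^\ell\times\{0,1\}^k\to\{0,1\}^{k+1}$,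 $\mathrm{Gad}_f:\{0,1\}^n\to\{0,1\}^{n+1}$ with $n=\ell+k(\ell+1)$ reads its input as $v\in\{0,1\}^\ell$, $u^1,\dots,u^{\ell+1}\in\{0,1\}^k$ and outputs the concatenation of $f(v,u^s)$, $s=1,\dots,\ell+1$. $CV_{a,k}(v,u)$ is the value on $u\in\{0,1\}^k$ of the circuit with $k$ inputs and $k+1$ outputs described by the size-$a$ string $v$ (here $\ell=k^2$).
   Formalization: A propositional proof system is also required to satisfy |y| ≤ |x|^d + d whenever P(x,y) (formula size polynomial in proof size); the encoding of CV(v,u)≠b has auxiliary atoms only for gate values of the described circuit, while the given generator uses de Morgan circuits. *)

theory Defs
  imports Complex_Main "HOL-Library.Extended_Nat" "HOL-Library.Log_Nat"
begin

section \<open>Propositional formulas\<close>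

datatype fm =
    Atom nat
  | Const bool
  | Neg fm
  | And fm fm
  | Or fm fm
  | Imp fm fm

primrec sem :: "(nat \<Rightarrow> bool) \<Rightarrow> fm \<Rightarrow> bool" where
  "sem e (Atom i) = e i"
| "sem e (Const b) = b"
| "sem e (Neg p) = (\<not> sem e p)"
| "sem e (And p q) = (sem e p \<and> sem e q)"
| "sem e (Or p q) = (sem e p \<or> sem e q)"
| "sem e (Imp p q) = (sem e p \<longrightarrow> sem e q)"

definition taut :: "fm \<Rightarrow> bool" where
  "taut p \<longleftrightarrow> (\<forall>e. sem e p)"

primrec atoms :: "fm \<Rightarrow> nat set" where
  "atoms (Atom i) = {i}"
| "atoms (Const b) = {}"
| "atoms (Neg p) = atoms p"
| "atoms (And p q) = atoms p \<union> atoms q"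
| "atoms (Or p q) = atoms p \<union> atoms q"
| "atoms (Imp p q) = atoms p \<union> atoms q"

primrec fsize :: "fm \<Rightarrow> nat" where
  "fsize (Atom i) = 1"
| "fsize (Const b) = 1"
| "fsize (Neg p) = fsize p + 1"
| "fsize (And p q) = fsize p + fsize q + 1"
| "fsize (Or p q) = fsize p + fsize q + 1"
| "fsize (Imp p q) = fsize p + fsize q + 1"

primrec rename :: "(nat \<Rightarrow> nat) \<Rightarrow> fm \<Rightarrow> fm" where
  "rename f (Atom i) = Atom (f i)"
| "rename f (Const b) = Const b"
| "rename f (Neg p) = Neg (rename f p)"
| "rename f (And p q) = And (rename f p) (rename f q)"
| "rename f (Or p q) = Or (rename f p) (rename f q)"
| "rename f (Imp p q) = Imp (rename f p) (rename f q)"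

text \<open>Substitution of constants: atom \<open>i\<close> is replaced by \<open>b\<close> where \<open>r i = Some b\<close> and kept
  where \<open>r i = None\<close>.\<close>

primrec subst_const :: "(nat \<Rightarrow> bool option) \<Rightarrow> fm \<Rightarrow> fm" where
  "subst_const r (Atom i) = (case r i of None \<Rightarrow> Atom i | Some b \<Rightarrow> Const b)"
| "subst_const r (Const b) = Const b"
| "subst_const r (Neg p) = Neg (subst_const r p)"
| "subst_const r (And p q) = And (subst_const r p) (subst_const r q)"
| "subst_const r (Or p q) = Or (subst_const r p) (subst_const r q)"
| "subst_const r (Imp p q) = Imp (subst_const r p) (subst_const r q)"

definition Iff :: "fm \<Rightarrow> fm \<Rightarrow> fm" where
  "Iff p q = And (Imp p q) (Imp q p)"

fun Conj :: "fm list \<Rightarrow> fm" where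
  "Conj [] = Const True"
| "Conj [p] = p"
| "Conj (p # q # ps) = And p (Conj (q # ps))"

fun Disj :: "fm list \<Rightarrow> fm" where
  "Disj [] = Const False"
| "Disj [p] = p"
| "Disj (p # q # ps) = Or p (Disj (q # ps))"

definition lit :: "nat \<Rightarrow> bool \<Rightarrow> fm" where
  "lit i b = (if b then Atom i else Neg (Atom i))"

text \<open>Formulas as bit strings: a prefix-free code, with the indices of atoms in binary.\<close>

fun enc_nat :: "nat \<Rightarrow> bool list" where
  "enc_nat n = (if n = 0 then [False] else True # odd n # enc_nat (n div 2))"

declare enc_nat.simps [simp del]

primrec enc :: "fm \<Rightarrow> bool list" where
  "enc (Atom i) = [False, False, False] @ enc_nat i"
| "enc (Const b) = [False, False, True, b]"
| "enc (Neg p) = [False, True, False] @ enc p"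
| "enc (And p q) = [False, True, True] @ enc p @ enc q"
| "enc (Or p q) = [True, False, False] @ enc p @ enc q"
| "enc (Imp p q) = [True, False, True] @ enc p @ enc q"

lemma enc_nat_prefix_free: "enc_nat m @ xs = enc_nat n @ ys \<longleftrightarrow> m = n \<and> xs = ys"
proof (induction m arbitrary: n rule: less_induct)
  case (less m)
  show ?case
  proof (cases "m = 0 \<or> n = 0")
    case True
    then show ?thesis by (auto simp: enc_nat.simps[of m] enc_nat.simps[of n])
  next
    case False
    have "m = n \<longleftrightarrow> odd m = odd n \<and> m div 2 = n div 2"
      by (metis bit_eq_rec)
    with False less[of "m div 2" "n div 2"] show ?thesis
      by (auto simp: enc_nat.simps[of m] enc_nat.simps[of n])
  qed
qed

lemma enc_prefix_free: "enc p @ xs = enc q @ ys \<longleftrightarrow> p = q \<and> xs = ys"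
proof (induction p arbitrary: q xs ys)
  case (Atom i) then show ?case by (cases q) (auto simp: enc_nat_prefix_free)
next
  case (Const b) then show ?case by (cases q) auto
next
  case (Neg p) then show ?case by (cases q) auto
next
  case (And p1 p2) then show ?case by (cases q) auto
next
  case (Or p1 p2) then show ?case by (cases q) auto
next
  case (Imp p1 p2) then show ?case by (cases q) auto
qed

lemma inj_enc: "inj enc"
  using enc_prefix_free[of _ "[]" _ "[]"] by (auto intro: injI)


section \<open>Polynomial-time relations on bit strings\<close>

text \<open>Deterministic one-tape Turing machines with states \<open>{..<Q}\<close> and tape symbols \<open>{..<S}\<close>.
  State 2 is initial, the halting states are 1 (accept) and 0 (reject); symbol 0 is the blank,
  1 and 2 stand for the bits, and 3 separates the two arguments.\<close>

type_synonym tm = "nat \<Rightarrow> nat \<Rightarrow> nat \<times> nat \<times> int"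

type_synonym conf = "nat \<times> (int \<Rightarrow> nat) \<times> int"

definition tm_ok :: "nat \<Rightarrow> nat \<Rightarrow> tm \<Rightarrow> bool" where
  "tm_ok Q S M \<longleftrightarrow> 3 \<le> Q \<and> 4 \<le> S \<and>
     (\<forall>q<Q. \<forall>a<S. case M q a of (q', a', d) \<Rightarrow> q' < Q \<and> a' < S \<and> d \<in> {-1, 0, 1})"

definition tm_step :: "tm \<Rightarrow> conf \<Rightarrow> conf" where
  "tm_step M = (\<lambda>(q, T, h). if q \<le> 1 then (q, T, h)
     else (case M q (T h) of (q', a, d) \<Rightarrow> (q', T(h := a), h + d)))"

definition tm_init :: "bool list \<Rightarrow> bool list \<Rightarrow> conf" where
  "tm_init x y =
     (let sym = (\<lambda>b. if b then 2 else 1); z = map sym x @ [3] @ map sym y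
      in (2, (\<lambda>i. if 0 \<le> i \<and> i < int (length z) then z ! nat i else 0), 0))"

definition polytime_rel :: "(bool list \<Rightarrow> bool list \<Rightarrow> bool) \<Rightarrow> bool" where
  "polytime_rel R \<longleftrightarrow> (\<exists>Q S M a. tm_ok Q S M \<and>
     (\<forall>x y. \<exists>t \<le> (length x + length y) ^ a + a.
        fst ((tm_step M ^^ t) (tm_init x y)) = (if R x y then 1 else 0)))"


section \<open>Propositional proof systems\<close>

type_synonym pf_rel = "bool list \<Rightarrow> bool list \<Rightarrow> bool"

text \<open>\<open>P x y\<close> means that \<open>x\<close> is a proof of \<open>y\<close>. The last conjunct is the usual convention that
  the size of a proof accounts for the formula proved; it is automatic when a proof system is given
  as a polynomial-time function from proofs onto the tautologies. Without it, short proofs could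
  be decreed for an easily recognised set of very long formulas.\<close>

definition pps :: "pf_rel \<Rightarrow> bool" where
  "pps P \<longleftrightarrow> polytime_rel P \<and>
     (\<forall>y. (\<exists>x. P x y) \<longleftrightarrow> y \<in> enc ` {p. taut p}) \<and>
     (\<exists>d. \<forall>x y. P x y \<longrightarrow> length y \<le> length x ^ d + d)"

text \<open>The minimal size of a proof, \<open>\<infinity>\<close> if there is none.\<close>

definition min_size :: "pf_rel \<Rightarrow> fm \<Rightarrow> enat" where
  "min_size P p = (INF x\<in>{x. P x (enc p)}. enat (length x))"

definition simulates :: "pf_rel \<Rightarrow> pf_rel \<Rightarrow> bool" where
  "simulates P Q \<longleftrightarrow> (\<exists>c::nat. \<forall>p. taut p \<longrightarrow> min_size P p \<le> min_size Q p ^ c)"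


section \<open>Extended Frege\<close>

inductive frege_axiom :: "fm \<Rightarrow> bool" where
  "frege_axiom (Imp p (Imp q p))"
| "frege_axiom (Imp (Imp p (Imp q r)) (Imp (Imp p q) (Imp p r)))"
| "frege_axiom (Imp (Imp (Neg p) (Neg q)) (Imp q p))"
| "frege_axiom (Imp p (Imp q (And p q)))"
| "frege_axiom (Imp (And p q) p)"
| "frege_axiom (Imp (And p q) q)"
| "frege_axiom (Imp p (Or p q))"
| "frege_axiom (Imp q (Or p q))"
| "frege_axiom (Imp (Imp p r) (Imp (Imp q r) (Imp (Or p q) r)))"
| "frege_axiom (Const True)"
| "frege_axiom (Imp (Const False) p)"

text \<open>The three cases for a line of a derivation are axioms, modus ponens and the extension rule,
  where the extension atom must be new and must not occur in the formula proved.\<close>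

definition ef_derivation :: "fm list \<Rightarrow> fm \<Rightarrow> bool" where
  "ef_derivation ps p \<longleftrightarrow> ps \<noteq> [] \<and> last ps = p \<and>
     (\<forall>i < length ps.
        frege_axiom (ps ! i) \<or>
        (\<exists>j<i. \<exists>k<i. ps ! k = Imp (ps ! j) (ps ! i)) \<or>
        (\<exists>q r. ps ! i = Iff (Atom q) r \<and> q \<notin> atoms r \<and> q \<notin> atoms p \<and>
           (\<forall>j<i. q \<notin> atoms (ps ! j))))"

definition enc_list :: "fm list \<Rightarrow> bool list" where
  "enc_list ps = concat (map (\<lambda>p. True # enc p) ps) @ [False]"

definition EF :: pf_rel where
  "EF x y \<longleftrightarrow> (\<exists>ps p. ef_derivation ps p \<and> x = enc_list ps \<and> y = enc p)"


section \<open>Circuits\<close>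

text \<open>The wires of a circuit are numbered: first the inputs, then the gates. Gate \<open>j\<close> is given by
  a formula over the wires \<open>{..<ins C + j}\<close>, whose size counts towards the size of the circuit;
  usual circuits over the de Morgan basis are those all of whose gates are elementary.\<close>

datatype circuit = Circuit (ins: nat) (gates: "fm list") (outs: "nat list")

definition wires :: "circuit \<Rightarrow> nat" where
  "wires C = ins C + length (gates C)"

definition wf_circuit :: "circuit \<Rightarrow> bool" where
  "wf_circuit C \<longleftrightarrow> (\<forall>j < length (gates C). atoms (gates C ! j) \<subseteq> {..<ins C + j}) \<and>
     set (outs C) \<subseteq> {..<wires C}"

fun elementary :: "fm \<Rightarrow> bool" where
  "elementary (Const b) = True"
| "elementary (Neg (Atom i)) = True"
| "elementary (And (Atom i) (Atom j)) = True"
| "elementary (Or (Atom i) (Atom j)) = True"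
| "elementary _ = False"

definition csize :: "circuit \<Rightarrow> nat" where
  "csize C = ins C + sum_list (map fsize (gates C)) + length (outs C)"

primrec run :: "fm list \<Rightarrow> bool list \<Rightarrow> bool list" where
  "run [] w = w"
| "run (p # ps) w = run ps (w @ [sem (\<lambda>i. w ! i) p])"

definition ceval :: "circuit \<Rightarrow> bool list \<Rightarrow> bool list" where
  "ceval C x = map (\<lambda>i. run (gates C) x ! i) (outs C)"

definition computes :: "circuit \<Rightarrow> nat \<Rightarrow> nat \<Rightarrow> (bool list \<Rightarrow> bool list) \<Rightarrow> bool" where
  "computes C n m g \<longleftrightarrow> wf_circuit C \<and> ins C = n \<and> length (outs C) = m \<and>
     (\<forall>x. length x = n \<longrightarrow> ceval C x = g x)"

text \<open>The formula ``\<open>C(x) \<noteq> b\<close>'': if the atoms of the gates carry the values of the computation,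
  then some output bit differs from \<open>b\<close>. Wire \<open>i\<close> is represented by the atom \<open>\<nu> i\<close>.\<close>

definition tau :: "circuit \<Rightarrow> bool list \<Rightarrow> (nat \<Rightarrow> nat) \<Rightarrow> fm" where
  "tau C b \<nu> =
     Imp (Conj (map (\<lambda>j. Iff (Atom (\<nu> (ins C + j))) (rename \<nu> (gates C ! j)))
                    [0..<length (gates C)]))
         (Disj (map (\<lambda>i. lit (\<nu> (outs C ! i)) (\<not> b ! i)) [0..<length (outs C)]))"


section \<open>Proof complexity generators\<close>

text \<open>A family of functions \<open>g i\<close> from \<open>n i\<close> bits to \<open>m i\<close> bits, \<open>i \<ge> 1\<close>, with the circuits that
  present it. The index is the input length itself or, for the gadget generator, the parameter
  \<open>k\<close> that determines the input length.\<close>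

definition generator ::
  "(nat \<Rightarrow> nat) \<Rightarrow> (nat \<Rightarrow> nat) \<Rightarrow> (nat \<Rightarrow> bool list \<Rightarrow> bool list) \<Rightarrow> (nat \<Rightarrow> circuit) \<Rightarrow> bool"
where
  "generator n m g C \<longleftrightarrow>
     (\<forall>i\<ge>1. 1 \<le> n i \<and> n i < m i \<and> computes (C i) (n i) (m i) (g i)) \<and>
     (\<exists>a. \<forall>i\<ge>1. csize (C i) \<le> m i ^ a)"

text \<open>Computed by circuits (in the usual sense) of size polynomial in the input length.\<close>

definition nonuniform_polytime :: "(nat \<Rightarrow> circuit) \<Rightarrow> bool" where
  "nonuniform_polytime C \<longleftrightarrow> (\<exists>a. \<forall>i\<ge>1.
     (\<forall>p \<in> set (gates (C i)). elementary p) \<and> csize (C i) \<le> ins (C i) ^ a + a)"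

text \<open>The disjunctions \<open>\<tau>(g\<^sub>n)\<^sub>b \<or> \<dots>\<close> for the circuit \<open>C\<close>; joint injectivity of
  \<open>\<nu>\<close> says that distinct wires, within one disjunct and across disjuncts, get distinct atoms.\<close>

definition tau_disjunctions :: "circuit \<Rightarrow> fm set" where
  "tau_disjunctions C =
     {Disj (map (\<lambda>i. tau C (bs ! i) (\<nu> i)) [0..<length bs]) | bs \<nu>.
        bs \<noteq> [] \<and> (\<forall>b \<in> set bs. length b = length (outs C)) \<and>
        inj_on (\<lambda>(i, w). \<nu> i w) ({..<length bs} \<times> {..<wires C})}"

definition or_hard ::
  "pf_rel \<Rightarrow> (nat \<Rightarrow> nat) \<Rightarrow> (nat \<Rightarrow> nat) \<Rightarrow> (nat \<Rightarrow> bool list \<Rightarrow> bool list) \<Rightarrow> (nat \<Rightarrow> circuit) \<Rightarrow> bool"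
where
  "or_hard P n m g C \<longleftrightarrow> generator n m g C \<and>
     (\<forall>c\<ge>1. finite {D. \<exists>i\<ge>1. D \<in> tau_disjunctions (C i) \<and>
        (\<exists>x. P x (enc D) \<and> length x \<le> m i ^ c)})"


section \<open>Gadget generators\<close>

definition Gad :: "nat \<Rightarrow> nat \<Rightarrow> (bool list \<Rightarrow> bool list \<Rightarrow> bool list) \<Rightarrow> bool list \<Rightarrow> bool list" where
  "Gad l k f x = concat (map (\<lambda>s. f (take l x) (take k (drop (l + s * k) x))) [0..<l + 1])"

text \<open>If \<open>F\<close> is a circuit for \<open>f\<close> with inputs \<open>v, u\<close>, the circuit for the gadget generator
  consists of \<open>l + 1\<close> copies of \<open>F\<close> that share the inputs \<open>v\<close>.\<close>

definition gad_wire :: "nat \<Rightarrow> nat \<Rightarrow> circuit \<Rightarrow> nat \<Rightarrow> nat \<Rightarrow> nat" where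
  "gad_wire l k F s i =
     (if i < l then i
      else if i < l + k then l + s * k + (i - l)
      else l + k * (l + 1) + s * length (gates F) + (i - (l + k)))"

definition gad_circuit :: "nat \<Rightarrow> nat \<Rightarrow> circuit \<Rightarrow> circuit" where
  "gad_circuit l k F = Circuit (l + k * (l + 1))
     (concat (map (\<lambda>s. map (rename (gad_wire l k F s)) (gates F)) [0..<l + 1]))
     (concat (map (\<lambda>s. map (gad_wire l k F s) (outs F)) [0..<l + 1]))"


section \<open>The circuit value function\<close>

text \<open>A string of size \<open>a\<close> describes a circuit with \<open>k\<close> inputs, a constant wire 0 and
  \<open>cv_gates a k\<close> further gates; the last \<open>k + 1\<close> wires are the outputs. Each gate is described by
  a block of two bits for the connective and two pointers of \<open>cv_width a k\<close> bits (least
  significant bit first), which suffices to address all wires. Pointers that do not point to an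
  earlier wire are redirected to the constant wire.\<close>

definition cv_width :: "nat \<Rightarrow> nat \<Rightarrow> nat" where
  "cv_width a k = floorlog 2 (k + a)"

definition cv_block :: "nat \<Rightarrow> nat \<Rightarrow> nat" where
  "cv_block a k = 2 * cv_width a k + 2"

definition cv_gates :: "nat \<Rightarrow> nat \<Rightarrow> nat" where
  "cv_gates a k = a div cv_block a k"

definition pointer :: "nat \<Rightarrow> nat \<Rightarrow> bool list \<Rightarrow> nat" where
  "pointer pos w v = horner_sum of_bool 2 (map (\<lambda>t. v ! (pos + t)) [0..<w])"

definition described_gate :: "nat \<Rightarrow> nat \<Rightarrow> bool list \<Rightarrow> nat \<Rightarrow> fm" where
  "described_gate a k v j =
     (let pos = j * cv_block a k; w = cv_width a k;
          wire = (\<lambda>p. if p < k + 1 + j then p else k);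
          p = wire (pointer (pos + 2) w v);
          q = wire (pointer (pos + 2 + w) w v)
      in if \<not> v ! pos then Neg (Atom p)
         else if \<not> v ! (pos + 1) then And (Atom p) (Atom q)
         else Or (Atom p) (Atom q))"

definition described_circuit :: "nat \<Rightarrow> nat \<Rightarrow> bool list \<Rightarrow> circuit" where
  "described_circuit a k v = Circuit k
     (Const False # map (described_gate a k v) [0..<cv_gates a k])
     [cv_gates a k..<cv_gates a k + k + 1]"

definition CV :: "nat \<Rightarrow> nat \<Rightarrow> bool list \<Rightarrow> bool list \<Rightarrow> bool list" where
  "CV a k v u = ceval (described_circuit a k v) u"

text \<open>The circuit for \<open>CV a k\<close> has the inputs \<open>v\<close> (wires \<open>{..<a}\<close>) and \<open>u\<close>, and wire \<open>a + i\<close> carries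
  the value of wire \<open>i\<close> of the described circuit. As gates are formulas, the only auxiliary atoms
  in \<open>tau (cv_circuit a k)\<close> are those for the values of the gates of the described circuit.\<close>

definition selected :: "nat \<Rightarrow> nat \<Rightarrow> nat \<Rightarrow> nat \<Rightarrow> fm" where
  "selected a pos w N =
     Disj (map (\<lambda>i. And (Conj (map (\<lambda>t. lit (pos + t) (bit i t)) [0..<w])) (Atom (a + i))) [0..<N])"

definition cv_gate :: "nat \<Rightarrow> nat \<Rightarrow> nat \<Rightarrow> fm" where
  "cv_gate a k j =
     (let pos = j * cv_block a k; w = cv_width a k;
          p = selected a (pos + 2) w (k + 1 + j);
          q = selected a (pos + 2 + w) w (k + 1 + j)
      in Or (And (Neg (Atom pos)) (Neg p))
            (And (Atom pos)
               (Or (And (Neg (Atom (pos + 1))) (And p q))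
                   (And (Atom (pos + 1)) (Or p q)))))"

definition cv_circuit :: "nat \<Rightarrow> nat \<Rightarrow> circuit" where
  "cv_circuit a k = Circuit (a + k)
     (Const False # map (cv_gate a k) [0..<cv_gates a k])
     [a + cv_gates a k..<a + cv_gates a k + k + 1]"


section \<open>The circuits compute what they should\<close>

lemma sem_cong: "(\<And>i. i \<in> atoms p \<Longrightarrow> e i = e' i) \<Longrightarrow> sem e p = sem e' p"
  by (induction p) auto

lemma sem_rename: "sem e (rename f p) = sem (\<lambda>i. e (f i)) p"
  by (induction p) auto

lemma atoms_rename: "atoms (rename f p) = f ` atoms p"
  by (induction p) auto

lemma sem_Conj [simp]: "sem e (Conj ps) \<longleftrightarrow> (\<forall>p\<in>set ps. sem e p)"
  by (induction ps rule: Conj.induct) auto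

lemma sem_Disj [simp]: "sem e (Disj ps) \<longleftrightarrow> (\<exists>p\<in>set ps. sem e p)"
  by (induction ps rule: Disj.induct) auto

lemma sem_lit [simp]: "sem e (lit i b) \<longleftrightarrow> e i = b"
  by (auto simp: lit_def)

lemma atoms_Conj [simp]: "atoms (Conj ps) = (\<Union>p\<in>set ps. atoms p)"
  by (induction ps rule: Conj.induct) auto

lemma atoms_Disj [simp]: "atoms (Disj ps) = (\<Union>p\<in>set ps. atoms p)"
  by (induction ps rule: Disj.induct) auto

lemma atoms_lit [simp]: "atoms (lit i b) = {i}"
  by (auto simp: lit_def)

text \<open>The computation of a circuit is the unique list of values that satisfies the gate conditions.\<close>

lemma run_char:
  assumes "\<forall>j < length ps. atoms (ps ! j) \<subseteq> {..<length x + j}"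
  shows "w = run ps x \<longleftrightarrow> length w = length x + length ps \<and> take (length x) w = x \<and>
    (\<forall>j < length ps. w ! (length x + j) = sem (\<lambda>i. w ! i) (ps ! j))"
  using assms
proof (induction ps arbitrary: x)
  case Nil
  then show ?case by auto
next
  case (Cons p ps)
  let ?b = "sem (\<lambda>i. x ! i) p" and ?n = "length x"
  have at: "atoms p \<subseteq> {..<?n}" using Cons.prems[rule_format, of 0] by simp
  have "\<forall>j < length ps. atoms (ps ! j) \<subseteq> {..<length (x @ [?b]) + j}"
    using Cons.prems by force
  note IH = Cons.IH[OF this]
  have eq: "take (Suc ?n) w = x @ [?b] \<longleftrightarrow> take ?n w = x \<and> w ! ?n = sem (\<lambda>i. w ! i) p"
    if "length w = ?n + Suc (length ps)"
  proof -
    have "take (Suc ?n) w = take ?n w @ [w ! ?n]" using that by (simp add: take_Suc_conv_app_nth)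
    moreover have "sem (\<lambda>i. w ! i) p = ?b" if "take ?n w = x"
    proof (rule sem_cong)
      fix i assume "i \<in> atoms p"
      with at have "i < ?n" by auto
      then show "w ! i = x ! i" using that by (metis nth_take)
    qed
    ultimately show ?thesis using that by auto
  qed
  show ?case
    unfolding run.simps IH using eq by (auto simp: less_Suc_eq_0_disj all_conj_distrib)
qed

lemma length_run [simp]: "length (run ps x) = length x + length ps"
  by (induction ps arbitrary: x) auto

lemma length_concat_uniform:
  "(\<And>s. s < L \<Longrightarrow> length (f s) = N) \<Longrightarrow> length (concat (map f [0..<L])) = L * N"
  by (induction L) auto

lemma nth_concat_uniform:
  assumes "\<And>s. s < L \<Longrightarrow> length (f s) = N" "s < L" "j < N"
  shows "concat (map f [0..<L]) ! (s * N + j) = f s ! j"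
  using assms
proof (induction L)
  case (Suc L)
  have len: "length (concat (map f [0..<L])) = L * N"
    using Suc.prems(1) by (intro length_concat_uniform) simp
  show ?case
  proof (cases "s < L")
    case True
    then have "s * N + N \<le> L * N" using mult_le_mono1[of "s + 1" L N] by simp
    then have "s * N + j < L * N" using Suc.prems(3) by linarith
    with True Suc len show ?thesis by (simp add: nth_append)
  next
    case False
    then have "s = L" using Suc by simp
    with len Suc.prems show ?thesis by (simp add: nth_append)
  qed
qed simp

lemma gad_wire_less:
  assumes "i < l + k + j" "j \<le> length (gates F)" "s \<le> l"
  shows "gad_wire l k F s i < l + k * (l + 1) + (s * length (gates F) + j)"
proof -
  have "k * s \<le> k * l" using assms by simp
  then have "i + k * s < k + (l + k * l)" if "i < l + k" using that by linarith
  then show ?thesis using assms by (auto simp: gad_wire_def algebra_simps trans_less_add2)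
qed

lemma computes_gad_circuit:
  assumes F: "computes F (l + k) (k + 1) (\<lambda>x. f (take l x) (drop l x))"
  shows "computes (gad_circuit l k F) (l + k * (l + 1)) ((k + 1) * (l + 1)) (Gad l k f)"
proof -
  let ?G = "gates F" and ?n = "l + k * (l + 1)"
  let ?N = "length ?G"
  let ?ps = "gates (gad_circuit l k F)"
  have F_ins: "ins F = l + k" and F_outs: "length (outs F) = k + 1" and wfF: "wf_circuit F"
    using F by (auto simp: computes_def)
  have ins: "ins (gad_circuit l k F) = ?n" by (simp add: gad_circuit_def)
  have len: "length ?ps = (l + 1) * ?N"
    unfolding gad_circuit_def circuit.sel by (rule length_concat_uniform) simp
  have gate: "?ps ! (s * ?N + j) = rename (gad_wire l k F s) (?G ! j)" if "s \<le> l" "j < ?N" for s j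
  proof -
    have "?ps ! (s * ?N + j) = map (rename (gad_wire l k F s)) ?G ! j"
      unfolding gad_circuit_def circuit.sel using that by (intro nth_concat_uniform) auto
    with that show ?thesis by simp
  qed
  have split: "\<exists>s j'. s \<le> l \<and> j' < ?N \<and> j = s * ?N + j'" if "j < length ?ps" for j
  proof -
    have "0 < ?N" using that len by (cases ?N) auto
    moreover have "j div ?N < l + 1" using that len by (simp add: less_mult_imp_div_less)
    ultimately show ?thesis
      by (intro exI[of _ "j div ?N"] exI[of _ "j mod ?N"]) auto
  qed
  have atG: "atoms (?G ! j) \<subseteq> {..<l + k + j}" if "j < ?N" for j
    using wfF that by (auto simp: wf_circuit_def F_ins)
  have at: "atoms (?ps ! j) \<subseteq> {..<?n + j}" if j: "j < length ?ps" for j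
  proof -
    obtain s j' where *: "s \<le> l" "j' < ?N" "j = s * ?N + j'" using split[OF j] by auto
    show ?thesis
      unfolding * gate[OF *(1,2)] atoms_rename
      using atG[OF *(2)] * gad_wire_less[of _ l k j' F s] by fastforce
  qed
  have outs_len: "length (outs (gad_circuit l k F)) = (k + 1) * (l + 1)"
  proof -
    have "length (outs (gad_circuit l k F)) = (l + 1) * (k + 1)"
      unfolding gad_circuit_def circuit.sel by (rule length_concat_uniform) (simp add: F_outs)
    then show ?thesis by (simp add: mult.commute)
  qed
  have "set (outs (gad_circuit l k F)) \<subseteq> {..<wires (gad_circuit l k F)}"
  proof -
    have "gad_wire l k F s i < ?n + (l + 1) * ?N" if "s \<le> l" "i \<in> set (outs F)" for s i
    proof -
      have "i < l + k + ?N" using that wfF by (auto simp: wf_circuit_def wires_def F_ins)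
      from gad_wire_less[OF this _ that(1)] have "gad_wire l k F s i < ?n + (s * ?N + ?N)" by simp
      also have "s * ?N + ?N \<le> (l + 1) * ?N" using that(1) by simp
      finally show ?thesis by simp
    qed
    then show ?thesis unfolding wires_def len ins by (auto simp: gad_circuit_def)
  qed
  then have wf: "wf_circuit (gad_circuit l k F)"
    using at by (auto simp: wf_circuit_def ins)
  have "ceval (gad_circuit l k F) x = Gad l k f x" if x: "length x = ?n" for x
  proof -
    define W where "W = run ?ps x"
    have W: "take ?n W = x" "\<And>j. j < length ?ps \<Longrightarrow> W ! (?n + j) = sem (\<lambda>i. W ! i) (?ps ! j)"
      using run_char[of ?ps x W] at x by (auto simp: W_def)
    have copy: "map (\<lambda>i. W ! gad_wire l k F s i) (outs F)
        = f (take l x) (take k (drop (l + s * k) x))" if s: "s \<le> l" for s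
    proof -
      define u where "u = take k (drop (l + s * k) x)"
      have sk: "s * k + k \<le> k * (l + 1)" using s mult_le_mono[of "s + 1" "l + 1" k k] by (simp add: algebra_simps)
      have "k \<le> length x - (l + s * k)" using x sk by linarith
      then have lu: "length u = k" "length (take l x) = l" using x by (auto simp: u_def)
      define w where "w = map (\<lambda>i. W ! gad_wire l k F s i) [0..<l + k + ?N]"
      have "w = run ?G (take l x @ u)"
      proof (subst run_char, goal_cases)
        case 1 then show ?case using atG lu by simp
      next
        case 2
        have "take (l + k) w = take l x @ u"
        proof (rule nth_equalityI)
          fix i assume i: "i < length (take (l + k) w)"
          then have i': "i < l + k" by simp
          have Wx: "W ! i' = x ! i'" if "i' < ?n" for i' using W(1) that by (metis nth_take)
          have "w ! i = W ! gad_wire l k F s i" using i' by (simp add: w_def)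
          also have "\<dots> = x ! gad_wire l k F s i"
            using i' sk unfolding gad_wire_def by (intro Wx) (simp del: mult_Suc_right add_Suc_right)
          also have "\<dots> = (take l x @ u) ! i"
            using i' x sk lu by (auto simp: gad_wire_def nth_append u_def)
          finally show "take (l + k) w ! i = (take l x @ u) ! i" using i' by simp
        qed (use lu in \<open>simp add: w_def\<close>)
        moreover have "w ! (l + k + j) = sem (\<lambda>i. w ! i) (?G ! j)" if j: "j < ?N" for j
        proof -
          have "(s + 1) * ?N \<le> (l + 1) * ?N" using s by (intro mult_le_mono1) simp
          then have sN: "s * ?N + j < length ?ps" using j unfolding len add_mult_distrib by linarith
          have "w ! (l + k + j) = W ! (?n + (s * ?N + j))"
            using j by (simp add: w_def gad_wire_def algebra_simps)
          also have "\<dots> = sem (\<lambda>i. W ! gad_wire l k F s i) (?G ! j)"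
            using W(2)[OF sN] by (simp only: gate[OF s j] sem_rename)
          also have "\<dots> = sem (\<lambda>i. w ! i) (?G ! j)"
            using atG[OF j] j by (intro sem_cong) (auto simp: w_def)
          finally show ?thesis .
        qed
        ultimately show ?case using lu by (simp add: w_def)
      qed
      moreover have "map (\<lambda>i. W ! gad_wire l k F s i) (outs F) = map (\<lambda>i. w ! i) (outs F)"
        using wfF by (auto simp: w_def wf_circuit_def wires_def F_ins)
      ultimately have "map (\<lambda>i. W ! gad_wire l k F s i) (outs F) = ceval F (take l x @ u)"
        by (simp add: ceval_def)
      also have "\<dots> = f (take l x) u" using F lu by (auto simp: computes_def)
      finally show ?thesis by (simp add: u_def)
    qed
    have "ceval (gad_circuit l k F) x = map (\<lambda>i. W ! i) (outs (gad_circuit l k F))"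
      by (simp add: ceval_def W_def)
    also have "\<dots> = concat (map (\<lambda>s. map (\<lambda>i. W ! gad_wire l k F s i) (outs F)) [0..<l + 1])"
      unfolding gad_circuit_def circuit.sel map_concat map_map by (simp add: comp_def)
    also have "\<dots> = Gad l k f x"
      unfolding Gad_def by (intro arg_cong[where f = concat] map_cong refl copy) auto
    finally show ?thesis .
  qed
  then show ?thesis using wf ins outs_len by (auto simp: computes_def)
qed

lemma sem_selected:
  assumes "N \<le> 2 ^ w"
  shows "sem e (selected a pos w N) \<longleftrightarrow>
    (let p = pointer pos w (map e [0..<pos + w]) in p < N \<and> e (a + p))"
proof -
  let ?p = "pointer pos w (map e [0..<pos + w])"
  have p: "bit ?p t \<longleftrightarrow> t < w \<and> e (pos + t)" for t
    by (auto simp: pointer_def bit_horner_sum_bit_iff)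
  have "(\<forall>t<w. e (pos + t) = bit i t) \<longleftrightarrow> i = ?p" if "i < N" for i
  proof
    have big: "\<not> bit i t" if "w \<le> t" for t
    proof -
      have "i < 2 ^ t" using \<open>i < N\<close> assms that
        by (meson less_le_trans one_le_numeral power_increasing)
      then show ?thesis by (simp add: bit_iff_odd)
    qed
    assume "\<forall>t<w. e (pos + t) = bit i t"
    then show "i = ?p" by (intro bit_eqI) (metis big p not_less)
  qed (auto simp: p)
  then have "(\<exists>i<N. (\<forall>t<w. e (pos + t) = bit i t) \<and> e (a + i)) \<longleftrightarrow> ?p < N \<and> e (a + ?p)"
    by blast
  moreover have "(\<forall>t\<in>{0..<w}. Q t) \<longleftrightarrow> (\<forall>t<w. Q t)" for Q by auto
  ultimately show ?thesis by (simp add: selected_def Let_def Bex_def)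
qed

lemma pointer_cong:
  "(\<And>t. t < w \<Longrightarrow> v ! (pos + t) = v' ! (pos + t)) \<Longrightarrow> pointer pos w v = pointer pos w v'"
  unfolding pointer_def by (intro arg_cong[where f = "horner_sum of_bool 2"] map_cong) auto

lemma computes_cv_circuit:
  "computes (cv_circuit a k) (a + k) (k + 1) (\<lambda>x. CV a k (take a x) (drop a x))"
proof -
  let ?t = "cv_gates a k" and ?w = "cv_width a k" and ?b = "cv_block a k"
  have bt: "j * ?b + ?b \<le> a" if "j < ?t" for j
  proof -
    have "(j + 1) * ?b \<le> ?t * ?b" using that by (intro mult_le_mono1) simp
    also have "\<dots> \<le> a" by (simp add: cv_gates_def)
    finally show ?thesis by simp
  qed
  have tw: "k + 1 + j \<le> 2 ^ ?w" if "j < ?t" for j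
  proof -
    have "j < a" using that bt[OF that] by (auto simp: cv_block_def intro: less_le_trans[of _ "j * ?b + ?b"])
    moreover from this have "k + a < 2 ^ ?w" unfolding cv_width_def by (intro floorlog_leD) auto
    ultimately show ?thesis by simp
  qed
  have at: "atoms (gates (cv_circuit a k) ! j) \<subseteq> {..<a + k + j}" if "j < length (gates (cv_circuit a k))" for j
  proof (cases j)
    case (Suc i)
    with that have i: "i < ?t" by (simp add: cv_circuit_def)
    have "i * ?b + (2 * ?w + 2) \<le> a" using bt[OF i] by (simp add: cv_block_def)
    then show ?thesis using Suc i
      by (auto simp: cv_circuit_def cv_gate_def selected_def Let_def)
  qed (simp add: cv_circuit_def)
  have wf: "wf_circuit (cv_circuit a k)"
    using at by (auto simp: wf_circuit_def cv_circuit_def wires_def)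
  have "ceval (cv_circuit a k) x = CV a k (take a x) (drop a x)" if x: "length x = a + k" for x
  proof -
    define v u where "v = take a x" and "u = drop a x"
    have lv: "length v = a" "length u = k" using x by (auto simp: u_def v_def)
    define W where "W = run (gates (cv_circuit a k)) x"
    have lW: "length W = a + k + (?t + 1)" by (simp add: W_def x cv_circuit_def)
    have W: "take (a + k) W = x" "\<And>j. j < ?t + 1 \<Longrightarrow> W ! (a + k + j) = sem (\<lambda>i. W ! i) (gates (cv_circuit a k) ! j)"
      using run_char[of "gates (cv_circuit a k)" x W] at x by (auto simp: W_def cv_circuit_def)
    have Wv: "W ! i = v ! i" if "i < a" for i
      using W(1) that unfolding v_def by (metis nth_take trans_less_add1)
    define D where "D = described_circuit a k v"
    have atD: "atoms (gates D ! j) \<subseteq> {..<k + j}" if "j < length (gates D)" for j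
      using that by (cases j) (auto simp: D_def described_circuit_def described_gate_def Let_def)
    have "drop a W = run (gates D) u"
    proof (subst run_char, goal_cases)
      case 1 then show ?case using atD lv by simp
    next
      case 2
      have "take k (drop a W) = u"
        using W(1) by (simp add: u_def take_drop add.commute)
      moreover have "drop a W ! (k + j) = sem (\<lambda>i. drop a W ! i) (gates D ! j)" if j: "j < ?t + 1" for j
      proof (cases j)
        case 0
        then show ?thesis using W(2)[of 0] lW
          by (simp add: D_def described_circuit_def cv_circuit_def)
      next
        case (Suc i)
        with j have i: "i < ?t" by simp
        let ?pos = "i * ?b"
        have pos: "?pos + 2 + ?w + ?w \<le> a" using bt[OF i] by (simp add: cv_block_def)
        have sel: "sem (\<lambda>i. W ! i) (selected a q ?w (k + 1 + i)) \<longleftrightarrow>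
            drop a W ! (if pointer q ?w v < k + 1 + i then pointer q ?w v else k)"
          if "q + ?w \<le> a" for q
        proof -
          have "pointer q ?w (map ((!) W) [0..<q + ?w]) = pointer q ?w v"
            using that Wv by (intro pointer_cong) auto
          moreover have "\<not> W ! (a + k)" using W(2)[of 0] by (simp add: cv_circuit_def)
          ultimately show ?thesis
            unfolding sem_selected[OF tw[OF i]] Let_def using lW i by auto
        qed
        have "drop a W ! (k + j) = sem (\<lambda>i. W ! i) (cv_gate a k i)"
          using W(2)[OF j] j Suc i lW by (simp add: cv_circuit_def add.assoc)
        also have "\<dots> = sem (\<lambda>i. drop a W ! i) (described_gate a k v i)"
        proof -
          have "?pos < a" "?pos + 1 < a" "?pos + 2 + ?w \<le> a" using pos by linarith+
          then show ?thesis
            unfolding cv_gate_def described_gate_def Let_def sem.simps sel[OF pos]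
            using Wv by (simp add: sel del: One_nat_def add_2_eq_Suc')
        qed
        finally show ?thesis using Suc i by (simp add: D_def described_circuit_def)
      qed
      moreover have "length (gates D) = ?t + 1" by (simp add: D_def described_circuit_def)
      ultimately show ?case using lv lW by (simp del: nth_drop drop_append)
    qed
    then have "ceval D u = map (\<lambda>i. drop a W ! i) [?t..<?t + k + 1]"
      by (simp add: ceval_def D_def described_circuit_def)
    also have "\<dots> = map (\<lambda>i. W ! i) [a + ?t..<a + ?t + k + 1]"
      using lW by (intro nth_equalityI) (auto simp: nth_append add.assoc)
    also have "\<dots> = ceval (cv_circuit a k) x"
      by (simp add: ceval_def W_def cv_circuit_def)
    finally show ?thesis by (simp add: CV_def D_def u_def v_def)
  qed
  then show ?thesis using wf by (auto simp: computes_def cv_circuit_def)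
qed

corollary computes_gad_cv_circuit:
  "computes (gad_circuit (k\<^sup>2) k (cv_circuit (k\<^sup>2) k)) (k\<^sup>2 + k * (k\<^sup>2 + 1))
   (k\<^sup>2 + k * (k\<^sup>2 + 1) + 1) (Gad (k\<^sup>2) k (CV (k\<^sup>2) k))"
  using computes_gad_circuit[OF computes_cv_circuit, of "k\<^sup>2" k]
  by (simp add: algebra_simps)

end

theory Submission
  imports Defs
begin

text \<open>Suppose the gadget generator has short \<open>P\<close>-proofs of disjunctions for infinitely many \<open>k\<close>. Given
  such a \<open>k\<close>, take \<open>n\<close> with \<open>k\<close> roughly \<open>n ^ (a + 1)\<close>, where \<open>C n\<close> has size about \<open>n ^ a\<close>, and pad
  \<open>g\<close> to \<open>(x, z) \<mapsto> (first n + 1 bits of g x, z)\<close> on \<open>k\<close> bits. The padded circuit has \<open>O(k)\<close> gates, so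
  it is described by some \<open>v\<close> of \<open>k\<^sup>2\<close> bits. Substitute constants for all atoms of the
  disjunction except those that carry wires of copies of \<open>C n\<close>: the bits of \<open>v\<close>, the inputs \<open>z\<close> and
  the outputs (both read off the target string), and the idle gates. The instance implies a
  disjunction for \<open>g\<close>, one disjunct for each block of each original disjunct, with polynomial-size
  Frege proofs and without extension atoms. Closure of \<open>P\<close> under substitution and modus ponens then
  contradicts the hardness of \<open>g\<close>.\<close>

section \<open>Frege derivations and their size\<close>

text \<open>The padding splits each block of \<open>k + 1\<close> target bits: its last
  \<open>k - n\<close> bits dictate \<open>z\<close>, so a block can be missed only in its first
  \<open>n + 1\<close> bits, and these are a target for \<open>g\<close>. As all copies share the
  constant string \<open>v\<close>, the blocks become independent instances of \<open>g\<close>, and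
  it stays open which of them is missed. So even a single formula for the gadget generator turns
  into a long disjunction for \<open>g\<close>; this is why hardness for disjunctions is the notion
  that carries over. Premises and conclusions change roles. Output wires of a copy are replaced by
  target bits, so its output literals become false. What survives of an output is the equation of a
  gate copying a wire of \<open>C n\<close> to a constant: it says that the output bit is right, the
  negation of an output literal for \<open>g\<close>. So each old premise is trivial or follows from
  one new premise or one negated new literal, an argument about at most three atoms. The exponent
  \<open>a + 1\<close> balances two needs: \<open>n ^ (a + 1) \<le> k\<close> keeps
  \<open>C n\<close> linear in \<open>k\<close>, and \<open>k < (n + 1) ^ (a + 1)\<close> keeps
  \<open>k\<close> polynomial in \<open>m n\<close>, so that short proofs stay short when measured
  for \<open>g\<close>.\<close>

inductive derives :: "fm set \<Rightarrow> fm \<Rightarrow> bool" (infix \<open>\<turnstile>\<close> 50) for \<Gamma> where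
  derives_hyp: "p \<in> \<Gamma> \<Longrightarrow> \<Gamma> \<turnstile> p"
| derives_axiom: "frege_axiom p \<Longrightarrow> \<Gamma> \<turnstile> p"
| derives_mp: "\<Gamma> \<turnstile> p \<Longrightarrow> \<Gamma> \<turnstile> Imp p q \<Longrightarrow> \<Gamma> \<turnstile> q"

lemma derives_weaken: "\<Gamma> \<turnstile> p \<Longrightarrow> \<Gamma> \<subseteq> \<Delta> \<Longrightarrow> \<Delta> \<turnstile> p"
  by (induction rule: derives.induct) (auto intro: derives.intros)

lemma derives_refl: "\<Gamma> \<turnstile> Imp p p"
proof -
  have "\<Gamma> \<turnstile> Imp p (Imp (Imp p p) p)" "\<Gamma> \<turnstile> Imp p (Imp p p)"
    "\<Gamma> \<turnstile> Imp (Imp p (Imp (Imp p p) p)) (Imp (Imp p (Imp p p)) (Imp p p))"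
    by (intro derives_axiom frege_axiom.intros)+
  then show ?thesis by (blast intro: derives_mp)
qed

lemma derives_const: "\<Gamma> \<turnstile> p \<Longrightarrow> \<Gamma> \<turnstile> Imp q p"
  by (erule derives_mp) (intro derives_axiom frege_axiom.intros)

lemma derives_ax1: "frege_axiom (Imp p q) \<Longrightarrow> \<Gamma> \<turnstile> p \<Longrightarrow> \<Gamma> \<turnstile> q"
  by (blast intro: derives_mp derives_axiom)

lemma derives_ax2: "frege_axiom (Imp p (Imp q r)) \<Longrightarrow> \<Gamma> \<turnstile> p \<Longrightarrow> \<Gamma> \<turnstile> q \<Longrightarrow> \<Gamma> \<turnstile> r"
  by (rule derives_mp[of _ q]) (auto intro: derives_ax1)

lemma deduction: "insert p \<Gamma> \<turnstile> q \<Longrightarrow> \<Gamma> \<turnstile> Imp p q"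
proof (induction rule: derives.induct)
  case (derives_hyp q)
  then show ?case
    by (auto intro: derives_refl derives_const derives.derives_hyp)
next
  case (derives_axiom q)
  then show ?case by (rule derives_const[OF derives.derives_axiom])
next
  case (derives_mp q r)
  show ?case by (rule derives_ax2[OF frege_axiom.intros(2) derives_mp.IH(2,1)])
qed

lemma derives_exfalso: "\<Gamma> \<turnstile> Const False \<Longrightarrow> \<Gamma> \<turnstile> p"
  by (rule derives_ax1[OF frege_axiom.intros(11)])

lemma derives_contradiction: "\<Gamma> \<turnstile> p \<Longrightarrow> \<Gamma> \<turnstile> Neg p \<Longrightarrow> \<Gamma> \<turnstile> q"
  by (rule derives_ax2[OF frege_axiom.intros(3)]) (rule derives_const)

text \<open>Contraposition against the axiom \<open>Const True\<close>: ex falso gives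
  \<open>Imp (Neg p) (Neg (Const True))\<close>, hence \<open>Imp (Const True) p\<close>.\<close>

lemma derives_ccontr:
  assumes "insert (Neg p) \<Gamma> \<turnstile> Const False"
  shows "\<Gamma> \<turnstile> p"
proof -
  have "\<Gamma> \<turnstile> Imp (Neg p) (Neg (Const True))"
    by (rule deduction[OF derives_exfalso[OF assms]])
  then show ?thesis
    by (rule derives_ax2[OF frege_axiom.intros(3)]) (intro derives_axiom frege_axiom.intros)
qed

text \<open>The one axiom scheme about negation removes it, so the goal \<open>Neg p\<close> is
  itself proved by contradiction, which requires recovering \<open>p\<close> from
  \<open>Neg (Neg p)\<close>.\<close>

lemma derives_NegI:
  assumes "insert p \<Gamma> \<turnstile> Const False"
  shows "\<Gamma> \<turnstile> Neg p"
proof (rule derives_ccontr)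
  have "insert (Neg p) (insert (Neg (Neg p)) \<Gamma>) \<turnstile> Const False"
    by (rule derives_contradiction[of _ "Neg p"]) (auto intro: derives_hyp)
  then have "insert (Neg (Neg p)) \<Gamma> \<turnstile> p" by (rule derives_ccontr)
  moreover have "insert (Neg (Neg p)) \<Gamma> \<turnstile> Imp p (Const False)"
    using deduction[OF assms] by (rule derives_weaken) auto
  ultimately show "insert (Neg (Neg p)) \<Gamma> \<turnstile> Const False" by (rule derives_mp)
qed

lemma derives_AndI: "\<Gamma> \<turnstile> p \<Longrightarrow> \<Gamma> \<turnstile> q \<Longrightarrow> \<Gamma> \<turnstile> And p q"
  by (rule derives_ax2[OF frege_axiom.intros(4)])

lemma derives_AndD: "\<Gamma> \<turnstile> And p q \<Longrightarrow> \<Gamma> \<turnstile> p" "\<Gamma> \<turnstile> And p q \<Longrightarrow> \<Gamma> \<turnstile> q"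
  by (rule derives_ax1[OF frege_axiom.intros(5)], assumption)
    (rule derives_ax1[OF frege_axiom.intros(6)])

lemma derives_OrI: "\<Gamma> \<turnstile> p \<Longrightarrow> \<Gamma> \<turnstile> Or p q" "\<Gamma> \<turnstile> q \<Longrightarrow> \<Gamma> \<turnstile> Or p q"
  by (rule derives_ax1[OF frege_axiom.intros(7)], assumption)
    (rule derives_ax1[OF frege_axiom.intros(8)])

lemma derives_OrE: "\<Gamma> \<turnstile> Or p q \<Longrightarrow> \<Gamma> \<turnstile> Imp p r \<Longrightarrow> \<Gamma> \<turnstile> Imp q r \<Longrightarrow> \<Gamma> \<turnstile> r"
  by (rule derives_mp[of _ "Or p q"], assumption) (rule derives_ax2[OF frege_axiom.intros(9)])

section \<open>Completeness by Kalmar's argument\<close>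

definition signed :: "bool \<Rightarrow> fm \<Rightarrow> fm" where
  "signed b p = (if b then p else Neg p)"

lemma signed_simps [simp]: "signed True p = p" "signed False p = Neg p"
  by (simp_all add: signed_def)

lemma kalmar:
  assumes "\<And>x. x \<in> atoms p \<Longrightarrow> \<Gamma> \<turnstile> signed (e x) (Atom x)"
  shows "\<Gamma> \<turnstile> signed (sem e p) p"
  using assms
proof (induction p)
  case (Const b)
  have "\<Gamma> \<turnstile> Neg (Const False)" by (rule derives_NegI) (auto intro: derives_hyp)
  then show ?case by (cases b) (auto intro: derives_axiom frege_axiom.intros)
next
  case (Neg p)
  then have IH: "\<Gamma> \<turnstile> signed (sem e p) p" by auto
  show ?case
  proof (cases "sem e p")
    case True
    have "insert (Neg p) \<Gamma> \<turnstile> Const False"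
      using derives_weaken[OF IH subset_insertI, of "Neg p"] True
      by - (rule derives_contradiction[of _ p], auto intro: derives_hyp)
    then show ?thesis using True by (auto intro: derives_NegI)
  qed (use IH in auto)
next
  case (And p q)
  then have IH: "\<Gamma> \<turnstile> signed (sem e p) p" "\<Gamma> \<turnstile> signed (sem e q) q" by auto
  have "\<Gamma> \<turnstile> Neg (And p q)" if "\<not> sem e p \<or> \<not> sem e q"
  proof (rule derives_NegI)
    have "insert (And p q) \<Gamma> \<turnstile> And p q" by (auto intro: derives_hyp)
    then have "insert (And p q) \<Gamma> \<turnstile> p" "insert (And p q) \<Gamma> \<turnstile> q" by (auto dest: derives_AndD)
    with that IH[THEN derives_weaken, OF subset_insertI, of "And p q"]
      derives_contradiction[of "insert (And p q) \<Gamma>" p "Const False"]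
      derives_contradiction[of "insert (And p q) \<Gamma>" q "Const False"]
    show "insert (And p q) \<Gamma> \<turnstile> Const False" by auto
  qed
  with IH show ?case by (auto simp: signed_def intro: derives_AndI split: if_splits)
next
  case (Or p q)
  then have IH: "\<Gamma> \<turnstile> signed (sem e p) p" "\<Gamma> \<turnstile> signed (sem e q) q" by auto
  have "\<Gamma> \<turnstile> Neg (Or p q)" if "\<not> sem e p" "\<not> sem e q"
  proof (rule derives_NegI)
    let ?G = "insert (Or p q) \<Gamma>"
    have n: "?G \<turnstile> Neg p" "?G \<turnstile> Neg q"
      using IH[THEN derives_weaken, OF subset_insertI, of "Or p q"] that by auto
    have "?G \<turnstile> Imp r (Const False)" if "?G \<turnstile> Neg r" for r
      by (rule deduction, rule derives_contradiction[of _ r])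
        (auto intro: derives_hyp derives_weaken[OF that])
    with n show "?G \<turnstile> Const False"
      by - (rule derives_OrE[of _ p q], auto intro: derives_hyp)
  qed
  with IH show ?case by (auto simp: signed_def intro: derives_OrI split: if_splits)
next
  case (Imp p q)
  then have IH: "\<Gamma> \<turnstile> signed (sem e p) p" "\<Gamma> \<turnstile> signed (sem e q) q" by auto
  consider "sem e q" | "\<not> sem e p" | "sem e p" "\<not> sem e q" by auto
  then show ?case
  proof cases
    case 1
    with IH(2) have "insert p \<Gamma> \<turnstile> q" by (auto intro: derives_weaken)
    then show ?thesis using 1 by (auto intro: deduction)
  next
    case 2
    then have "insert p \<Gamma> \<turnstile> q"
      using derives_weaken[OF IH(1) subset_insertI, of p]
      by - (rule derives_contradiction[of _ p], auto intro: derives_hyp)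
    then show ?thesis using 2 by (auto intro: deduction)
  next
    case 3
    let ?G = "insert (Imp p q) \<Gamma>"
    have "?G \<turnstile> p" "?G \<turnstile> Neg q" using IH[THEN derives_weaken, OF subset_insertI, of "Imp p q"] 3 by auto
    moreover have "?G \<turnstile> Imp p q" by (auto intro: derives_hyp)
    ultimately have "?G \<turnstile> Const False"
      using derives_contradiction[OF derives_mp[of ?G p q]] by blast
    then show ?thesis using 3 by (auto intro: derives_NegI)
  qed
qed auto

lemma derives_cases:
  assumes "insert p \<Gamma> \<turnstile> q" "insert (Neg p) \<Gamma> \<turnstile> q"
  shows "\<Gamma> \<turnstile> q"
proof (rule derives_ccontr)
  have "insert (Neg q) \<Gamma> \<turnstile> Neg p"
  proof (rule derives_NegI)
    have "insert p (insert (Neg q) \<Gamma>) \<turnstile> q" using assms(1) by (rule derives_weaken) auto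
    then show "insert p (insert (Neg q) \<Gamma>) \<turnstile> Const False"
      by (rule derives_contradiction) (auto intro: derives_hyp)
  qed
  moreover have "insert (Neg q) \<Gamma> \<turnstile> Imp (Neg p) q"
    using deduction[OF assms(2)] by (rule derives_weaken) auto
  ultimately have "insert (Neg q) \<Gamma> \<turnstile> q" by (rule derives_mp)
  then show "insert (Neg q) \<Gamma> \<turnstile> Const False"
    by (rule derives_contradiction) (auto intro: derives_hyp)
qed

lemma finite_atoms [simp]: "finite (atoms p)"
  by (induction p) auto

text \<open>The signed atoms that serve as hypotheses in \<open>kalmar\<close> are eliminated one by
  one by \<open>derives_cases\<close>. The derivation is exponential in the number of atoms; this is
  harmless because only finitely many fixed schemata are derived this way.\<close>

lemma completeness:
  assumes "taut p"
  shows "{} \<turnstile> p"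
proof -
  have "(\<lambda>x. signed (e x) (Atom x)) ` (atoms p - X) \<turnstile> p" if "finite X" for e X
    using that
  proof (induction X arbitrary: e)
    case empty
    have "(\<lambda>x. signed (e x) (Atom x)) ` atoms p \<turnstile> signed (sem e p) p"
      by (rule kalmar) (auto intro: derives_hyp)
    then show ?case using assms by (simp add: taut_def)
  next
    case (insert y X)
    let ?S = "\<lambda>e. (\<lambda>x. signed (e x) (Atom x)) ` (atoms p - X)"
    let ?T = "(\<lambda>x. signed (e x) (Atom x)) ` (atoms p - insert y X)"
    have "?S (e(y := True)) \<subseteq> insert (Atom y) ?T" "?S (e(y := False)) \<subseteq> insert (Neg (Atom y)) ?T"
      by auto
    with insert.IH[of "e(y := True)"] insert.IH[of "e(y := False)"]
    show ?case by - (rule derives_cases[of "Atom y" ?T], auto elim: derives_weaken)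
  qed
  from this[of "atoms p"] show ?thesis by simp
qed

section \<open>Derivations measured by code length\<close>

abbreviation len :: "fm \<Rightarrow> nat" where
  "len p \<equiv> length (enc p)"

text \<open>Extension atoms are never needed, so the derivations below are plain Frege proofs; the first
  argument bounds the total code length of the lines of a tree-like derivation.\<close>

inductive pr :: "nat \<Rightarrow> fm \<Rightarrow> bool" where
  pr_axiom: "frege_axiom p \<Longrightarrow> len p + 1 \<le> s \<Longrightarrow> pr s p"
| pr_mp: "pr s p \<Longrightarrow> pr t (Imp p q) \<Longrightarrow> s + t + len q + 1 \<le> u \<Longrightarrow> pr u q"

lemma pr_mono: "pr s p \<Longrightarrow> s \<le> t \<Longrightarrow> pr t p"
  by (induction rule: pr.induct) (auto intro: pr.intros)

lemma derives_imp_pr: "{} \<turnstile> p \<Longrightarrow> \<exists>s. pr s p"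
  by (induction rule: derives.induct) (auto, auto intro: pr_axiom dest: pr_mp[OF _ _ order_refl])

text \<open>A derivation tree is listed premises first. Each line costs its code and the flag bit
  that \<open>enc_list\<close> puts before it; the final 1 is the end marker of the list.\<close>

lemma pr_imp_EF:
  assumes "pr s p"
  shows "\<exists>x. EF x (enc p) \<and> length x \<le> s + 1"
proof -
  let ?ok = "\<lambda>ps. \<forall>i < length ps. frege_axiom (ps ! i) \<or>
        (\<exists>j<i. \<exists>k<i. ps ! k = Imp (ps ! j) (ps ! i))"
  have "\<exists>ps. ps \<noteq> [] \<and> last ps = p \<and> ?ok ps \<and> length (enc_list ps) \<le> s + 1"
    using assms
  proof (induction rule: pr.induct)
    case (pr_axiom p s)
    then show ?case by (intro exI[of _ "[p]"]) (auto simp: enc_list_def)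
  next
    case (pr_mp s p t q u)
    then obtain ps qs where ps: "ps \<noteq> []" "last ps = p" "?ok ps" "length (enc_list ps) \<le> s + 1"
      and qs: "qs \<noteq> []" "last qs = Imp p q" "?ok qs" "length (enc_list qs) \<le> t + 1" by blast
    let ?rs = "ps @ qs @ [q]"
    have "frege_axiom (?rs ! i) \<or> (\<exists>j<i. \<exists>k<i. ?rs ! k = Imp (?rs ! j) (?rs ! i))"
      if i: "i < length ?rs" for i
    proof -
      consider "i < length ps" | i' where "i = length ps + i'" "i' < length qs"
        | "i = length ps + length qs"
        using i by (auto simp: less_Suc_eq) (metis less_diff_conv2 le_add_diff_inverse not_le add.commute)
      then show ?thesis
      proof cases
        case 1
        then have "?rs ! j = ps ! j" if "j \<le> i" for j using that by (simp add: nth_append)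
        with ps(3) 1 show ?thesis by (metis less_imp_le order_refl)
      next
        case 2
        have nth: "?rs ! (length ps + j) = qs ! j" if "j \<le> i'" for j
          using that 2 by (simp add: nth_append)
        from qs(3) 2 consider "frege_axiom (qs ! i')"
          | j k where "j < i'" "k < i'" "qs ! k = Imp (qs ! j) (qs ! i')" by blast
        then show ?thesis
        proof cases
          case 2
          then have "?rs ! (length ps + k) = Imp (?rs ! (length ps + j)) (?rs ! i)"
            using nth[of j] nth[of k] nth[of i'] \<open>i = _\<close> by simp
          moreover have "length ps + k < i" "length ps + j < i" using 2 \<open>i = _\<close> by auto
          ultimately show ?thesis by blast
        qed (use nth 2 in auto)
      next
        case 3
        have "?rs ! (length ps - 1) = p" "?rs ! (length ps + (length qs - 1)) = Imp p q" "?rs ! i = q"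
          using ps(1,2) qs(1,2) 3 by (auto simp: nth_append last_conv_nth)
        moreover have "length ps - 1 < i" "length ps + (length qs - 1) < i"
          using ps(1) qs(1) 3 by (auto simp: Suc_le_eq neq_Nil_conv)
        ultimately show ?thesis by metis
      qed
    qed
    moreover have "length (enc_list ?rs) \<le> u + 1"
      using ps(4) qs(4) pr_mp.hyps by (simp add: enc_list_def)
    ultimately show ?case by (intro exI[of _ ?rs]) auto
  qed
  then show ?thesis unfolding EF_def ef_derivation_def by blast
qed

section \<open>Instances of fixed tautologies\<close>

primrec subst :: "(nat \<Rightarrow> fm) \<Rightarrow> fm \<Rightarrow> fm" where
  "subst f (Atom i) = f i"
| "subst f (Const b) = Const b"
| "subst f (Neg p) = Neg (subst f p)"
| "subst f (And p q) = And (subst f p) (subst f q)"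
| "subst f (Or p q) = Or (subst f p) (subst f q)"
| "subst f (Imp p q) = Imp (subst f p) (subst f q)"

lemma len_ge_4: "4 \<le> len p"
  by (induction p) (auto simp: enc_nat.simps)

lemma len_subst_le:
  assumes "\<And>i. len (f i) \<le> B"
  shows "len (subst f p) \<le> len p * B"
proof -
  have "1 \<le> B" using assms[of 0] len_ge_4[of "f 0"] by simp
  then show ?thesis
  proof (induction p)
    case (Atom i)
    then show ?case using assms[of i] by (simp add: trans_le_add1)
  qed (auto simp: algebra_simps)
qed

lemma frege_axiom_subst: "frege_axiom p \<Longrightarrow> frege_axiom (subst f p)"
  by (induction rule: frege_axiom.induct) (auto intro: frege_axiom.intros)

text \<open>The axioms are schemata, so substituting in every line keeps a derivation, and each line
  grows at most by the factor \<open>B\<close>. A proof of a fixed schema thus gives proofs of its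
  instances whose size is linear in the substituted formulas.\<close>

lemma pr_subst:
  assumes "pr s p" and f: "\<And>i. len (f i) \<le> B"
  shows "pr (s * B) (subst f p)"
  using assms(1)
proof (induction rule: pr.induct)
  case (pr_axiom p s)
  have "len (subst f p) + 1 \<le> (len p + 1) * B"
    using len_subst_le[where B = B and f = f and p = p, OF f] f[of 0] len_ge_4[of "f 0"] by (simp; linarith)
  also have "\<dots> \<le> s * B" using pr_axiom by (intro mult_le_mono1) simp
  finally show ?case using pr_axiom by (auto intro: pr.pr_axiom frege_axiom_subst)
next
  case (pr_mp s p t q u)
  have "s * B + t * B + len (subst f q) + 1 \<le> (s + t + len q + 1) * B"
    using len_subst_le[where B = B and f = f and p = q, OF f] f[of 0] len_ge_4[of "f 0"]
    by (simp add: add_mult_distrib; linarith)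
  also have "\<dots> \<le> u * B" using pr_mp by (intro mult_le_mono1) simp
  finally show ?case using pr_mp by (auto intro: pr.pr_mp)
qed

lemma finite_len_le: "finite {p. len p \<le> n}"
proof -
  have "finite {x :: bool list. length x \<le> n}"
    using finite_lists_length_le[of "UNIV :: bool set" n] by simp
  then show ?thesis
    using finite_vimageI[OF _ inj_enc] by (force simp: vimage_def)
qed

text \<open>There are only finitely many tautologies of length at most 200, so one constant serves for all
  the schemata used below.\<close>

lemma schema_constant_exists:
  "\<exists>c. \<forall>p. taut p \<longrightarrow> len p \<le> 200 \<longrightarrow> pr c p"
proof -
  note finite_len_le[of 200]
  moreover define T where "T = {p. taut p \<and> len p \<le> 200}"
  ultimately have fin: "finite T" by simp
  obtain s where s: "pr (s p) p" if "p \<in> T" for p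
    using derives_imp_pr completeness unfolding T_def mem_Collect_eq by metis
  have "pr (Max (s ` T)) p" if "p \<in> T" for p
    using s[OF that] by (rule pr_mono) (use fin that in auto)
  then show ?thesis unfolding T_def by blast
qed

text \<open>The summand 1000 is slack: at \<open>B\<close> per unit it pays for the conclusions of
  the modus ponens steps that apply a schema, so that each application below costs just
  \<open>schema_const * B\<close>.\<close>

definition schema_const :: nat where
  "schema_const = (SOME c. \<forall>p. taut p \<longrightarrow> len p \<le> 200 \<longrightarrow> pr c p) + 1000"

lemma pr_schema:
  assumes "taut \<sigma>" "len \<sigma> \<le> 200" "\<And>i. len (f i) \<le> B"
  shows "pr ((schema_const - 1000) * B) (subst f \<sigma>)"
proof (rule pr_subst[OF _ assms(3)])
  show "pr (schema_const - 1000) \<sigma>"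
    using someI_ex[OF schema_constant_exists] assms(1,2) unfolding schema_const_def by simp
qed

text \<open>Atom \<open>i\<close> of a schema stands for the \<open>i\<close>-th list entry. The
  default \<open>Const True\<close> has a code of length 4, which is where the side condition
  \<open>4 \<le> B\<close> of the rules comes from.\<close>

definition args :: "fm list \<Rightarrow> nat \<Rightarrow> fm" where
  "args ps i = (if i < length ps then ps ! i else Const True)"

lemma args_simps [simp]:
  "args (p # ps) 0 = p" "args (p # ps) (Suc i) = args ps i"
  "args (p # ps) 1 = args ps 0" "args (p # ps) (numeral n) = args ps (pred_numeral n)"
  by (simp_all add: args_def numeral_eq_Suc)

lemma len_args: "(\<forall>p\<in>set ps. len p \<le> B) \<Longrightarrow> 4 \<le> B \<Longrightarrow> len (args ps i) \<le> B"
  by (auto simp: args_def)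

lemma len_subst_args:
  "(\<forall>p\<in>set ps. len p \<le> B) \<Longrightarrow> 4 \<le> B \<Longrightarrow> len \<sigma> \<le> n \<Longrightarrow> len (subst (args ps) \<sigma>) \<le> n * B"
  by (rule order_trans[OF len_subst_le mult_le_mono1]) (auto intro: len_args)

lemma pr_rule0:
  assumes "taut \<sigma>" "len \<sigma> \<le> 200" "\<forall>p\<in>set ps. len p \<le> B" "4 \<le> B"
  shows "pr (schema_const * B) (subst (args ps) \<sigma>)"
  using pr_schema[OF assms(1,2) len_args[OF assms(3,4)]]
  by (rule pr_mono) simp

lemma pr_rule1:
  assumes "pr s (subst (args ps) \<sigma>)" "taut (Imp \<sigma> \<tau>)" "len (Imp \<sigma> \<tau>) \<le> 200"
    "\<forall>p\<in>set ps. len p \<le> B" "4 \<le> B"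
  shows "pr (s + schema_const * B) (subst (args ps) \<tau>)"
proof -
  have imp: "pr ((schema_const - 1000) * B) (Imp (subst (args ps) \<sigma>) (subst (args ps) \<tau>))"
    using pr_schema[OF assms(2,3) len_args[OF assms(4,5)]] by simp
  have le: "len (subst (args ps) \<tau>) \<le> 200 * B"
    using assms(3) by (intro len_subst_args[OF assms(4,5)]) simp
  have "schema_const * B = (schema_const - 1000) * B + 1000 * B" by (simp add: schema_const_def add_mult_distrib)
  then show ?thesis using le assms(5)
    by - (rule pr_mp[OF assms(1) imp], linarith)
qed

lemma pr_rule2:
  assumes "pr s (subst (args ps) \<sigma>)" "pr t (subst (args ps) \<rho>)"
    "taut (Imp \<sigma> (Imp \<rho> \<tau>))" "len (Imp \<sigma> (Imp \<rho> \<tau>)) \<le> 200"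
    "\<forall>p\<in>set ps. len p \<le> B" "4 \<le> B"
  shows "pr (s + t + schema_const * B) (subst (args ps) \<tau>)"
proof -
  have imp: "pr ((schema_const - 1000) * B) (Imp (subst (args ps) \<sigma>) (Imp (subst (args ps) \<rho>) (subst (args ps) \<tau>)))"
    using pr_schema[OF assms(3,4) len_args[OF assms(5,6)]] by simp
  have le: "len (subst (args ps) \<tau>) \<le> 200 * B" "len (subst (args ps) (Imp \<rho> \<tau>)) \<le> 200 * B"
    using assms(4) by (intro len_subst_args[OF assms(5,6)]; simp)+
  \<comment> \<open>The intermediate implication costs at most \<open>200 * B + 1\<close>, and so
    does the final conclusion; both fit into the slack \<open>1000 * B\<close>.\<close>
  have "pr (s + (schema_const - 1000) * B + 201 * B) (Imp (subst (args ps) \<rho>) (subst (args ps) \<tau>))"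
    using assms(6) le(2) by - (rule pr_mp[OF assms(1) imp], simp)
  moreover have "schema_const * B = (schema_const - 1000) * B + 1000 * B" by (simp add: schema_const_def add_mult_distrib)
  ultimately show ?thesis using assms(6) le(1)
    by - (rule pr_mp[OF assms(2)], assumption, linarith)
qed

text \<open>The rules are restated with equations between the actual formulas and the instances, so
  that each use names a small propositional schema and the matching is plain simplification.\<close>

lemma pr_by0:
  "taut \<sigma> \<Longrightarrow> subst (args ps) \<sigma> = p \<Longrightarrow> len \<sigma> \<le> 200 \<Longrightarrow> \<forall>p\<in>set ps. len p \<le> B \<Longrightarrow> 4 \<le> B \<Longrightarrow>
    schema_const * B \<le> u \<Longrightarrow> pr u p"
  using pr_rule0[of \<sigma> ps B] by (blast intro: pr_mono)

lemma pr_by1: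
  "pr s p \<Longrightarrow> taut (Imp \<sigma> \<tau>) \<Longrightarrow> subst (args ps) \<sigma> = p \<Longrightarrow> subst (args ps) \<tau> = q \<Longrightarrow>
    len (Imp \<sigma> \<tau>) \<le> 200 \<Longrightarrow> \<forall>p\<in>set ps. len p \<le> B \<Longrightarrow> 4 \<le> B \<Longrightarrow> s + schema_const * B \<le> u \<Longrightarrow> pr u q"
  using pr_rule1[of s ps \<sigma> \<tau> B] by (blast intro: pr_mono)

lemma pr_by2:
  "pr s p \<Longrightarrow> pr t q \<Longrightarrow> taut (Imp \<sigma> (Imp \<rho> \<tau>)) \<Longrightarrow> subst (args ps) \<sigma> = p \<Longrightarrow>
    subst (args ps) \<rho> = q \<Longrightarrow> subst (args ps) \<tau> = r \<Longrightarrow>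
    len (Imp \<sigma> (Imp \<rho> \<tau>)) \<le> 200 \<Longrightarrow> \<forall>p\<in>set ps. len p \<le> B \<Longrightarrow> 4 \<le> B \<Longrightarrow>
    s + t + schema_const * B \<le> u \<Longrightarrow> pr u r"
  using pr_rule2[of s ps \<sigma> t \<rho> \<tau> B] by (blast intro: pr_mono)

section \<open>Short proofs by three-valued evaluation\<close>

lemma enc_nat_small [simp]:
  "enc_nat 0 = [False]" "enc_nat 1 = [True, True, False]" "enc_nat (Suc 0) = [True, True, False]"
  "enc_nat 2 = [True, False, True, True, False]" "enc_nat 3 = [True, True, True, True, False]"
  by (simp_all add: enc_nat.simps)

text \<open>Strong Kleene evaluation under a partial assignment. A gate of the circuit value function
  mentions all wires, but once its description bits are fixed its Kleene value depends on at most
  two of them; this is what makes its equivalence with an elementary gate provable by cases.\<close>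

definition kand :: "bool option \<Rightarrow> bool option \<Rightarrow> bool option" where
  "kand x y = (if x = Some False \<or> y = Some False then Some False
     else if x = Some True \<and> y = Some True then Some True else None)"

definition kor :: "bool option \<Rightarrow> bool option \<Rightarrow> bool option" where
  "kor x y = (if x = Some True \<or> y = Some True then Some True
     else if x = Some False \<and> y = Some False then Some False else None)"

lemma kand_eq_Some: "kand x y = Some b \<longleftrightarrow>
    (if b then x = Some True \<and> y = Some True else x = Some False \<or> y = Some False)"
  by (cases x; cases y; cases b) (auto simp: kand_def)

lemma kor_eq_Some: "kor x y = Some b \<longleftrightarrow>
    (if b then x = Some True \<or> y = Some True else x = Some False \<and> y = Some False)"
  by (cases x; cases y; cases b) (auto simp: kor_def)

primrec keval :: "(nat \<Rightarrow> bool option) \<Rightarrow> fm \<Rightarrow> bool option" where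
  "keval \<rho> (Atom i) = \<rho> i"
| "keval \<rho> (Const b) = Some b"
| "keval \<rho> (Neg p) = map_option Not (keval \<rho> p)"
| "keval \<rho> (And p q) = kand (keval \<rho> p) (keval \<rho> q)"
| "keval \<rho> (Or p q) = kor (keval \<rho> p) (keval \<rho> q)"
| "keval \<rho> (Imp p q) = kor (map_option Not (keval \<rho> p)) (keval \<rho> q)"

lemma fsize_pos [simp]: "1 \<le> fsize p"
  by (induction p) auto

text \<open>Only operands whose value is determined are followed. A conjunction with one false
  operand is refuted from that operand, and the other one enters merely as a side formula of a
  schema; hence \<rho> need not be defined on all atoms of \<open>p\<close>, and each node costs one
  schema.\<close>

lemma pr_keval:
  assumes "keval \<rho> p = Some b"
    and "\<And>x c. \<rho> x = Some c \<Longrightarrow> x \<in> atoms p \<Longrightarrow> pr s (Imp L (signed c (Atom x)))"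
    and "len p \<le> B" "len L \<le> B"
  shows "pr (fsize p * (s + schema_const * B)) (Imp L (signed b p))"
proof -
  have B: "4 \<le> B" using len_ge_4[of L] assms(4) by linarith
  show ?thesis using assms(1-3)
  proof (induction p arbitrary: b)
    case (Atom x)
    then show ?case by (auto intro: pr_mono)
  next
    case (Const c)
    show ?case
    proof (cases b)
      case True
      show ?thesis
        by (rule pr_by0[where ps = "[L]" and B = B and \<sigma> = "Imp (Atom 0) (Const True)"])
          (use True Const assms(4) B in \<open>simp_all add: taut_def add_mult_distrib\<close>)
    next
      case False
      show ?thesis
        by (rule pr_by0[where ps = "[L]" and B = B and \<sigma> = "Imp (Atom 0) (Neg (Const False))"])
          (use False Const assms(4) B in \<open>simp_all add: taut_def add_mult_distrib\<close>)
    qed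
  next
    case (Neg p)
    then obtain b' where b': "keval \<rho> p = Some b'" "b = (\<not> b')" by auto
    have len: "len p \<le> B" using Neg.prems by simp
    have IH: "pr (fsize p * (s + schema_const * B)) (Imp L (signed b' p))"
      using Neg.IH[OF b'(1)] Neg.prems len by simp
    show ?case
    proof (cases b)
      case True
      show ?thesis using IH True b' by (auto elim!: pr_mono intro: le_add2)
    next
      case False
      show ?thesis
        by (rule pr_by1[OF IH, where ps = "[L, p]" and B = B and \<sigma> = "Imp (Atom 0) (Atom 1)"
            and \<tau> = "Imp (Atom 0) (Neg (Neg (Atom 1)))"])
          (use b' False assms(4) B len in \<open>simp_all add: taut_def add_mult_distrib\<close>)
    qed
  next
    case (And p q)
    have len: "len p \<le> B" "len q \<le> B" using And.prems by auto
    have IHp: "pr (fsize p * (s + schema_const * B)) (Imp L (signed c p))" if "keval \<rho> p = Some c" for c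
      using And.IH(1)[OF that] And.prems len by simp
    have IHq: "pr (fsize q * (s + schema_const * B)) (Imp L (signed c q))" if "keval \<rho> q = Some c" for c
      using And.IH(2)[OF that] And.prems len by simp
    consider "keval \<rho> p = Some False" "\<not> b" | "keval \<rho> q = Some False" "\<not> b"
      | "keval \<rho> p = Some True" "keval \<rho> q = Some True" "b"
      using And.prems(1) by (cases b) (auto simp: kand_eq_Some)
    then show ?case
    proof cases
      case 1
      show ?thesis
        by (rule pr_by1[OF IHp[OF 1(1)], where ps = "[L, p, q]" and B = B and \<sigma> = "Imp (Atom 0) (Neg (Atom 1))"
            and \<tau> = "Imp (Atom 0) (Neg (And (Atom 1) (Atom 2)))"])
          (use 1 len assms(4) B in \<open>simp_all add: taut_def add_mult_distrib\<close>)
    next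
      case 2
      show ?thesis
        by (rule pr_by1[OF IHq[OF 2(1)], where ps = "[L, p, q]" and B = B and \<sigma> = "Imp (Atom 0) (Neg (Atom 2))"
            and \<tau> = "Imp (Atom 0) (Neg (And (Atom 1) (Atom 2)))"])
          (use 2 len assms(4) B in \<open>simp_all add: taut_def add_mult_distrib\<close>)
    next
      case 3
      show ?thesis
        by (rule pr_by2[OF IHp[OF 3(1)] IHq[OF 3(2)], where ps = "[L, p, q]" and B = B and \<sigma> = "Imp (Atom 0) (Atom 1)"
            and \<rho> = "Imp (Atom 0) (Atom 2)" and \<tau> = "Imp (Atom 0) (And (Atom 1) (Atom 2))"])
          (use 3 len assms(4) B in \<open>simp_all add: taut_def add_mult_distrib\<close>)
    qed
  next
    case (Or p q)
    have len: "len p \<le> B" "len q \<le> B" using Or.prems by auto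
    have IHp: "pr (fsize p * (s + schema_const * B)) (Imp L (signed c p))" if "keval \<rho> p = Some c" for c
      using Or.IH(1)[OF that] Or.prems len by simp
    have IHq: "pr (fsize q * (s + schema_const * B)) (Imp L (signed c q))" if "keval \<rho> q = Some c" for c
      using Or.IH(2)[OF that] Or.prems len by simp
    consider "keval \<rho> p = Some True" "b" | "keval \<rho> q = Some True" "b"
      | "keval \<rho> p = Some False" "keval \<rho> q = Some False" "\<not> b"
      using Or.prems(1) by (cases b) (auto simp: kor_eq_Some)
    then show ?case
    proof cases
      case 1
      show ?thesis
        by (rule pr_by1[OF IHp[OF 1(1)], where ps = "[L, p, q]" and B = B and \<sigma> = "Imp (Atom 0) (Atom 1)"
            and \<tau> = "Imp (Atom 0) (Or (Atom 1) (Atom 2))"])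
          (use 1 len assms(4) B in \<open>simp_all add: taut_def add_mult_distrib\<close>)
    next
      case 2
      show ?thesis
        by (rule pr_by1[OF IHq[OF 2(1)], where ps = "[L, p, q]" and B = B and \<sigma> = "Imp (Atom 0) (Atom 2)"
            and \<tau> = "Imp (Atom 0) (Or (Atom 1) (Atom 2))"])
          (use 2 len assms(4) B in \<open>simp_all add: taut_def add_mult_distrib\<close>)
    next
      case 3
      show ?thesis
        by (rule pr_by2[OF IHp[OF 3(1)] IHq[OF 3(2)], where ps = "[L, p, q]" and B = B and \<sigma> = "Imp (Atom 0) (Neg (Atom 1))"
            and \<rho> = "Imp (Atom 0) (Neg (Atom 2))" and \<tau> = "Imp (Atom 0) (Neg (Or (Atom 1) (Atom 2)))"])
          (use 3 len assms(4) B in \<open>simp_all add: taut_def add_mult_distrib\<close>)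
    qed
  next
    case (Imp p q)
    have len: "len p \<le> B" "len q \<le> B" using Imp.prems by auto
    have IHp: "pr (fsize p * (s + schema_const * B)) (Imp L (signed c p))" if "keval \<rho> p = Some c" for c
      using Imp.IH(1)[OF that] Imp.prems len by simp
    have IHq: "pr (fsize q * (s + schema_const * B)) (Imp L (signed c q))" if "keval \<rho> q = Some c" for c
      using Imp.IH(2)[OF that] Imp.prems len by simp
    consider "keval \<rho> p = Some False" "b" | "keval \<rho> q = Some True" "b"
      | "keval \<rho> p = Some True" "keval \<rho> q = Some False" "\<not> b"
      using Imp.prems(1) by (cases b) (auto simp: kor_eq_Some)
    then show ?case
    proof cases
      case 1
      show ?thesis
        by (rule pr_by1[OF IHp[OF 1(1)], where ps = "[L, p, q]" and B = B and \<sigma> = "Imp (Atom 0) (Neg (Atom 1))"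
            and \<tau> = "Imp (Atom 0) (Imp (Atom 1) (Atom 2))"])
          (use 1 len assms(4) B in \<open>simp_all add: taut_def add_mult_distrib\<close>)
    next
      case 2
      show ?thesis
        by (rule pr_by1[OF IHq[OF 2(1)], where ps = "[L, p, q]" and B = B and \<sigma> = "Imp (Atom 0) (Atom 2)"
            and \<tau> = "Imp (Atom 0) (Imp (Atom 1) (Atom 2))"])
          (use 2 len assms(4) B in \<open>simp_all add: taut_def add_mult_distrib\<close>)
    next
      case 3
      show ?thesis
        by (rule pr_by2[OF IHp[OF 3(1)] IHq[OF 3(2)], where ps = "[L, p, q]" and B = B and \<sigma> = "Imp (Atom 0) (Atom 1)"
            and \<rho> = "Imp (Atom 0) (Neg (Atom 2))" and \<tau> = "Imp (Atom 0) (Neg (Imp (Atom 1) (Atom 2)))"])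
          (use 3 len assms(4) B in \<open>simp_all add: taut_def add_mult_distrib\<close>)
    qed
  qed
qed

primrec literals :: "(nat \<Rightarrow> bool) \<Rightarrow> nat list \<Rightarrow> fm" where
  "literals e [] = Const True"
| "literals e (x # xs) = And (signed (e x) (Atom x)) (literals e xs)"

lemma pr_literals_mem:
  "x \<in> set xs \<Longrightarrow> len (literals e xs) \<le> B \<Longrightarrow>
    pr (length xs * (schema_const * B)) (Imp (literals e xs) (signed (e x) (Atom x)))"
proof (induction xs)
  case (Cons y xs)
  have B: "4 \<le> B" using Cons.prems(2) len_ge_4[of "literals e xs"] by simp
  show ?case
  proof (cases "x = y")
    case True
    show ?thesis
      by (rule pr_by0[where ps = "[signed (e y) (Atom y), literals e xs]" and B = B and \<sigma> = "Imp (And (Atom 0) (Atom 1)) (Atom 0)"])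
        (use True Cons.prems B in \<open>simp_all add: taut_def add_mult_distrib\<close>)
  next
    case False
    have len: "len (signed (e x) (Atom x)) \<le> B" if "x \<in> set xs" "len (literals e xs) \<le> B" for xs
      using that by (induction xs) auto
    have IH: "pr (length xs * (schema_const * B)) (Imp (literals e xs) (signed (e x) (Atom x)))"
      using Cons False by simp
    show ?thesis
      by (rule pr_by1[OF IH, where ps = "[signed (e y) (Atom y), literals e xs, signed (e x) (Atom x)]" and B = B and \<sigma> = "Imp (Atom 1) (Atom 2)"
          and \<tau> = "Imp (And (Atom 0) (Atom 1)) (Atom 2)"])
        (use Cons.prems False B len[of xs] in \<open>simp_all add: taut_def add_mult_distrib\<close>)
  qed
qed simp

lemma literals_cong: "(\<And>x. x \<in> set xs \<Longrightarrow> e x = e' x) \<Longrightarrow> literals e xs = literals e' xs"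
  by (induction xs) auto

text \<open>Atoms are eliminated one at a time. Both branches are full proofs, so the size doubles
  with each atom; below there are at most three.\<close>

lemma pr_cases:
  assumes "\<And>e. pr s (Imp (literals e xs) p)" "distinct xs" "\<And>e. len (literals e xs) \<le> B" "len p \<le> B"
  shows "pr (2 ^ length xs * (s + 2 * schema_const * B)) p"
  using assms
proof (induction xs arbitrary: s)
  case Nil
  have B: "4 \<le> B" using len_ge_4[of p] Nil by simp
  show ?case
    by (rule pr_by1[OF Nil(1)[of undefined], where ps = "[p]" and B = B and \<sigma> = "Imp (Const True) (Atom 0)"
        and \<tau> = "Atom 0"])
      (use Nil(4) B in \<open>simp_all add: taut_def add_mult_distrib\<close>)
next
  case (Cons x xs)
  have B: "4 \<le> B" using len_ge_4[of p] Cons by simp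
  have len: "len (literals e xs) \<le> B" "len (Atom x) \<le> B" for e
    using Cons.prems(3)[of e] by (auto simp: signed_def split: if_splits)
  have "pr (2 * s + schema_const * B) (Imp (literals e xs) p)" for e
  proof -
    have "literals (e(x := b)) xs = literals e xs" for b
      using Cons.prems(2) by (intro literals_cong) auto
    then have *: "pr s (Imp (And (Atom x) (literals e xs)) p)" "pr s (Imp (And (Neg (Atom x)) (literals e xs)) p)"
      using Cons.prems(1)[of "e(x := True)"] Cons.prems(1)[of "e(x := False)"]
      by (simp_all add: fun_upd_def)
    show ?thesis
      by (rule pr_by2[OF *, where ps = "[Atom x, literals e xs, p]" and B = B and \<sigma> = "Imp (And (Atom 0) (Atom 1)) (Atom 2)"
          and \<rho> = "Imp (And (Neg (Atom 0)) (Atom 1)) (Atom 2)" and \<tau> = "Imp (Atom 1) (Atom 2)"])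
        (use len Cons.prems(4) B in \<open>auto simp: taut_def add_mult_distrib\<close>)
  qed
  from Cons.IH[OF this] have "pr (2 ^ length xs * (2 * s + schema_const * B + 2 * schema_const * B)) p"
    using Cons.prems len by simp
  \<comment> \<open>With \<open>K\<close> for \<open>schema_const * B\<close>, one step yields
    \<open>2 * s + 3 * K\<close>, at most \<open>2 * (s + 2 * K)\<close>; the factor 2 in the bound
    makes the induction close.\<close>
  then show ?case by (rule pr_mono) simp
qed

lemma fsize_le_len: "fsize p \<le> len p"
  by (induction p) auto

text \<open>Case distinction over \<open>X\<close> followed by Kleene evaluation. Three atoms
  suffice later: the wire of an elementary gate and the at most two wires that it reads. The formula
  \<open>p\<close> itself may be long and contain many more atoms.\<close>

lemma pr_local:
  assumes X: "finite X" "card X \<le> 3" "\<And>x. x \<in> X \<Longrightarrow> len (Atom x) \<le> B"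
    and p: "\<And>e. keval (\<lambda>x. if x \<in> X then Some (e x) else None) p = Some True" "len p \<le> B"
  shows "pr (1000 * schema_const * B\<^sup>2) p"
proof -
  define xs where "xs = sorted_list_of_set X"
  have xs: "set xs = X" "distinct xs" "length xs \<le> 3" using X by (auto simp: xs_def)
  have B: "4 \<le> B" using len_ge_4[of p] p by simp
  \<comment> \<open>Besides the atom, an entry costs three bits for \<open>And\<close> and at most
    three for \<open>Neg\<close>; the 4 is the closing \<open>Const True\<close>.\<close>
  have "len (literals e ys) \<le> 4 + length ys * (B + 6)" if "set ys \<subseteq> X" for ys e
    using that by (induction ys) (use X(3) in \<open>force simp: signed_def\<close>)+
  moreover have "length xs * (B + 6) \<le> 3 * (B + 6)" using xs by (intro mult_le_mono1)
  ultimately have len: "len (literals e xs) \<le> 12 * B" for e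
    using xs(1) B by (fastforce intro: order_trans)
  have *: "pr (48 * schema_const * B\<^sup>2) (Imp (literals e xs) p)" for e
  proof (rule pr_mono)
    have "pr (length xs * (schema_const * (12 * B))) (Imp (literals e xs) (signed (e x) (Atom x)))" if "x \<in> X" for x
      using that xs(1) len by (intro pr_literals_mem) auto
    then have "pr (fsize p * (length xs * (schema_const * (12 * B)) + schema_const * (12 * B))) (Imp (literals e xs) (signed True p))"
      using p(2) len[of e] by (intro pr_keval[OF p(1)[of e]]) (auto split: if_splits)
    then show "pr (fsize p * (length xs * (schema_const * (12 * B)) + schema_const * (12 * B))) (Imp (literals e xs) p)"
      by simp
    have "fsize p \<le> B" using fsize_le_len[of p] p(2) by simp
    moreover have "length xs * (schema_const * (12 * B)) + schema_const * (12 * B) \<le> 48 * schema_const * B"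
      using mult_le_mono1[OF xs(3), of "schema_const * (12 * B)"] by simp
    ultimately have "fsize p * (length xs * (schema_const * (12 * B)) + schema_const * (12 * B)) \<le> B * (48 * schema_const * B)"
      by (rule mult_le_mono)
    then show "fsize p * (length xs * (schema_const * (12 * B)) + schema_const * (12 * B)) \<le> 48 * schema_const * B\<^sup>2"
      by (simp add: power2_eq_square mult_ac)
  qed
  have "pr (2 ^ length xs * (48 * schema_const * B\<^sup>2 + 2 * schema_const * (12 * B))) p"
    using len p(2) by (intro pr_cases[OF * xs(2)]) auto
  then show ?thesis
  proof (rule pr_mono)
    \<comment> \<open>Eight branches at \<open>48 + 24\<close> units each make 576, rounded up to
      1000.\<close>
    have "(2::nat) ^ length xs \<le> 2 ^ 3" using xs(3) by (intro power_increasing) auto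
    moreover have "24 * schema_const * B \<le> 24 * schema_const * B\<^sup>2" using B by (simp add: power2_eq_square)
    ultimately have "2 ^ length xs * (48 * schema_const * B\<^sup>2 + 2 * schema_const * (12 * B)) \<le> 2 ^ 3 * (48 * schema_const * B\<^sup>2 + 24 * schema_const * B\<^sup>2)"
      by (intro mult_le_mono) auto
    then show "2 ^ length xs * (48 * schema_const * B\<^sup>2 + 2 * schema_const * (12 * B)) \<le> 1000 * schema_const * B\<^sup>2" by simp
  qed
qed

section \<open>Rules for long conjunctions and disjunctions\<close>

lemma len_Conj: "p \<in> set ps \<Longrightarrow> len p \<le> len (Conj ps)"
  by (induction ps rule: Conj.induct) auto

lemma len_Disj: "p \<in> set ps \<Longrightarrow> len p \<le> len (Disj ps)"
  by (induction ps rule: Disj.induct) auto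

lemma length_le_len_Conj: "length ps \<le> len (Conj ps)"
  by (induction ps rule: Conj.induct) (use len_ge_4 in \<open>auto intro: le_trans[OF _ len_ge_4]\<close>)

lemma length_le_len_Disj: "length ps \<le> len (Disj ps)"
  by (induction ps rule: Disj.induct) (use len_ge_4 in \<open>auto intro: le_trans[OF _ len_ge_4]\<close>)

lemma pr_Conj_elim:
  "p \<in> set ps \<Longrightarrow> len (Conj ps) \<le> B \<Longrightarrow> pr (length ps * (schema_const * B)) (Imp (Conj ps) p)"
proof (induction ps rule: Conj.induct)
  case (2 q)
  show ?case
    by (rule pr_by0[where ps = "[p]" and B = B and \<sigma> = "Imp (Atom 0) (Atom 0)"])
      (use 2 len_ge_4[of p] in \<open>auto simp: taut_def\<close>)
next
  case (3 q r ps)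
  let ?R = "Conj (r # ps)"
  have B: "4 \<le> B" "len q \<le> B" "len ?R \<le> B" "len p \<le> B"
    using 3(3) len_ge_4[of q] len_Conj[OF 3(2)] by auto
  show ?case
  proof (cases "p = q")
    case True
    show ?thesis
      by (rule pr_by0[where ps = "[q, ?R]" and B = B and \<sigma> = "Imp (And (Atom 0) (Atom 1)) (Atom 0)"])
        (use True B in \<open>simp_all add: taut_def add_mult_distrib\<close>)
  next
    case False
    then have IH: "pr (length (r # ps) * (schema_const * B)) (Imp ?R p)" using 3 B by auto
    show ?thesis
      by (rule pr_by1[OF IH, where ps = "[q, ?R, p]" and B = B and \<sigma> = "Imp (Atom 1) (Atom 2)"
          and \<tau> = "Imp (And (Atom 0) (Atom 1)) (Atom 2)"])
        (use B in \<open>simp_all add: taut_def add_mult_distrib\<close>)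
  qed
qed simp

lemma pr_Disj_intro:
  "p \<in> set ps \<Longrightarrow> len (Disj ps) \<le> B \<Longrightarrow> pr (length ps * (schema_const * B)) (Imp p (Disj ps))"
proof (induction ps rule: Disj.induct)
  case (2 q)
  show ?case
    by (rule pr_by0[where ps = "[p]" and B = B and \<sigma> = "Imp (Atom 0) (Atom 0)"])
      (use 2 len_ge_4[of p] in \<open>auto simp: taut_def\<close>)
next
  case (3 q r ps)
  let ?R = "Disj (r # ps)"
  have B: "4 \<le> B" "len q \<le> B" "len ?R \<le> B" "len p \<le> B"
    using 3(3) len_ge_4[of q] len_Disj[OF 3(2)] by auto
  show ?case
  proof (cases "p = q")
    case True
    show ?thesis
      by (rule pr_by0[where ps = "[q, ?R]" and B = B and \<sigma> = "Imp (Atom 0) (Or (Atom 0) (Atom 1))"])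
        (use True B in \<open>simp_all add: taut_def add_mult_distrib\<close>)
  next
    case False
    then have IH: "pr (length (r # ps) * (schema_const * B)) (Imp p ?R)" using 3 B by auto
    show ?thesis
      by (rule pr_by1[OF IH, where ps = "[q, ?R, p]" and B = B and \<sigma> = "Imp (Atom 2) (Atom 1)"
          and \<tau> = "Imp (Atom 2) (Or (Atom 0) (Atom 1))"])
        (use B in \<open>simp_all add: taut_def add_mult_distrib\<close>)
  qed
qed simp

lemma pr_Conj_intro:
  "(\<And>p. p \<in> set ps \<Longrightarrow> pr s (Imp H p)) \<Longrightarrow> len (Conj ps) \<le> B \<Longrightarrow> len H \<le> B \<Longrightarrow>
    pr ((length ps + 1) * (s + schema_const * B)) (Imp H (Conj ps))"
proof (induction ps rule: Conj.induct)
  case 1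
  show ?case
    by (rule pr_by0[where ps = "[H]" and B = B and \<sigma> = "Imp (Atom 0) (Const True)"])
      (use 1(3) len_ge_4[of H] in \<open>simp_all add: taut_def add_mult_distrib\<close>)
next
  case (2 q)
  then show ?case by (auto intro: pr_mono)
next
  case (3 q r ps)
  let ?R = "Conj (r # ps)"
  have B: "4 \<le> B" "len q \<le> B" "len ?R \<le> B" "len H \<le> B"
    using 3(3,4) len_ge_4[of q] by auto
  have IH: "pr ((length (r # ps) + 1) * (s + schema_const * B)) (Imp H ?R)" using 3 B by auto
  have q: "pr s (Imp H q)" using 3 by simp
  show ?case
    by (rule pr_by2[OF q IH, where ps = "[q, ?R, H]" and B = B and \<sigma> = "Imp (Atom 2) (Atom 0)"
        and \<rho> = "Imp (Atom 2) (Atom 1)" and \<tau> = "Imp (Atom 2) (And (Atom 0) (Atom 1))"])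
      (use B in \<open>simp_all add: taut_def add_mult_distrib\<close>)
qed

lemma pr_Disj_elim:
  "(\<And>p. p \<in> set ps \<Longrightarrow> pr s (Imp p G)) \<Longrightarrow> len (Disj ps) \<le> B \<Longrightarrow> len G \<le> B \<Longrightarrow>
    pr ((length ps + 1) * (s + schema_const * B)) (Imp (Disj ps) G)"
proof (induction ps rule: Disj.induct)
  case 1
  show ?case
    by (rule pr_by0[where ps = "[G]" and B = B and \<sigma> = "Imp (Const False) (Atom 0)"])
      (use 1(3) len_ge_4[of G] in \<open>simp_all add: taut_def add_mult_distrib\<close>)
next
  case (2 q)
  then show ?case by (auto intro: pr_mono)
next
  case (3 q r ps)
  let ?R = "Disj (r # ps)"
  have B: "4 \<le> B" "len q \<le> B" "len ?R \<le> B" "len G \<le> B"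
    using 3(3,4) len_ge_4[of q] by auto
  have IH: "pr ((length (r # ps) + 1) * (s + schema_const * B)) (Imp ?R G)" using 3 B by auto
  have q: "pr s (Imp q G)" using 3 by simp
  show ?case
    by (rule pr_by2[OF q IH, where ps = "[q, ?R, G]" and B = B and \<sigma> = "Imp (Atom 0) (Atom 2)"
        and \<rho> = "Imp (Atom 1) (Atom 2)" and \<tau> = "Imp (Or (Atom 0) (Atom 1)) (Atom 2)"])
      (use B in \<open>simp_all add: taut_def add_mult_distrib\<close>)
qed

text \<open>From the negation of \<open>D\<close> one obtains all gate equations and the negations of all output
  literals, hence every premise of \<open>T\<close>.\<close>

lemma pr_reduction:
  fixes As Ls Es Ms :: "nat \<Rightarrow> fm list" and Q R B :: nat
  defines "D \<equiv> Disj (map (\<lambda>q. Imp (Conj (As q)) (Disj (Ls q))) [0..<Q])"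
    and "T \<equiv> Disj (map (\<lambda>i. Imp (Conj (Es i)) (Disj (Ms i))) [0..<R])"
  assumes Es: "\<And>i E. i < R \<Longrightarrow> E \<in> set (Es i) \<Longrightarrow> \<exists>F. pr (1000 * schema_const * B\<^sup>2) (Imp F E) \<and>
      (F = Const True \<or> (\<exists>q<Q. F \<in> set (As q) \<or> F \<in> Neg ` set (Ls q)))"
    and Ms: "\<And>i. i < R \<Longrightarrow> pr (1000 * schema_const * B\<^sup>2) (Neg (Disj (Ms i)))"
    and B: "len D + 3 \<le> B" "len T \<le> B"
  shows "pr (10000 * schema_const * B ^ 4) (Imp T D)"
proof -
  define s K where "s = 1000 * schema_const * B\<^sup>2" and "K = schema_const * B"
  have B4: "4 \<le> B" using B len_ge_4[of D] by linarith
  have lenD: "len (Neg D) \<le> B" "len D \<le> B" using B by simp_all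
  have len_q: "len (Conj (As q)) \<le> B" "len (Disj (Ls q)) \<le> B" "length (As q) \<le> B"
    "length (Ls q) \<le> B" "Q \<le> B" "len (Imp (Conj (As q)) (Disj (Ls q))) \<le> B" if "q < Q" for q
  proof -
    have "len (Imp (Conj (As q)) (Disj (Ls q))) \<le> len D"
      unfolding D_def using that by (intro len_Disj) auto
    then show *: "len (Conj (As q)) \<le> B" "len (Disj (Ls q)) \<le> B"
      "len (Imp (Conj (As q)) (Disj (Ls q))) \<le> B" using B by auto
    show "length (As q) \<le> B" "length (Ls q) \<le> B"
      using length_le_len_Conj[of "As q"] length_le_len_Disj[of "Ls q"] * by auto
    show "Q \<le> B" using length_le_len_Disj[of "map (\<lambda>q. Imp (Conj (As q)) (Disj (Ls q))) [0..<Q]"] B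
      unfolding D_def by simp
  qed
  have inD: "pr (B * K) (Imp (Imp (Conj (As q)) (Disj (Ls q))) D)" if "q < Q" for q
    using pr_Disj_intro[of "Imp (Conj (As q)) (Disj (Ls q))"
        "map (\<lambda>q. Imp (Conj (As q)) (Disj (Ls q))) [0..<Q]" B] that lenD len_q(5)[OF that]
    unfolding D_def[symmetric] K_def by (auto elim: pr_mono)
  have avail: "pr (2 * B * K + K) (Imp (Neg D) F) \<and> len F \<le> B"
    if F: "F = Const True \<or> (\<exists>q<Q. F \<in> set (As q) \<or> F \<in> Neg ` set (Ls q))" for F
  proof -
    consider "F = Const True" | q where "q < Q" "F \<in> set (As q)"
      | q l where "q < Q" "F = Neg l" "l \<in> set (Ls q)" using F by auto
    then show ?thesis
    proof cases
      case 1
      have "pr (2 * B * K + K) (Imp (Neg D) F)"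
        by (rule pr_by0[where ps = "[D]" and B = B and \<sigma> = "Imp (Neg (Atom 0)) (Const True)"])
          (use 1 lenD B4 in \<open>simp_all add: taut_def K_def\<close>)
      then show ?thesis using 1 B4 by simp
    next
      case (2 q)
      have F: "len F \<le> B" using len_Conj[OF 2(2)] len_q(1)[OF 2(1)] by simp
      have "pr (B * K) (Imp (Conj (As q)) F)"
        using pr_Conj_elim[OF 2(2) len_q(1)[OF 2(1)]] len_q(3)[OF 2(1)]
        unfolding K_def by (auto elim: pr_mono)
      note this inD[OF 2(1)]
      then have "pr (2 * B * K + K) (Imp (Neg D) F)"
        by (rule pr_by2[where ps = "[Conj (As q), Disj (Ls q), D, F]" and B = B
              and \<sigma> = "Imp (Atom 0) (Atom 3)" and \<rho> = "Imp (Imp (Atom 0) (Atom 1)) (Atom 2)"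
              and \<tau> = "Imp (Neg (Atom 2)) (Atom 3)"])
          (use len_q[OF 2(1)] lenD B4 F in \<open>auto simp: taut_def K_def\<close>)
      then show ?thesis using F by simp
    next
      case (3 q l)
      have l: "len l \<le> B" using len_Disj[OF 3(3)] len_q(2)[OF 3(1)] by simp
      have "pr (B * K) (Imp l (Disj (Ls q)))"
        using pr_Disj_intro[OF 3(3) len_q(2)[OF 3(1)]] len_q(4)[OF 3(1)]
        unfolding K_def by (auto elim: pr_mono)
      note this inD[OF 3(1)]
      then have "pr (2 * B * K + K) (Imp (Neg D) F)"
        by (rule pr_by2[where ps = "[Conj (As q), Disj (Ls q), D, l]" and B = B
              and \<sigma> = "Imp (Atom 3) (Atom 1)" and \<rho> = "Imp (Imp (Atom 0) (Atom 1)) (Atom 2)"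
              and \<tau> = "Imp (Neg (Atom 2)) (Neg (Atom 3))"])
          (use len_q[OF 3(1)] lenD B4 l 3(2) in \<open>auto simp: taut_def K_def\<close>)
      \<comment> \<open>A negated output literal may exceed the code of every subformula of
        \<open>D\<close> by the three bits of \<open>Neg\<close>; this is why \<open>B\<close> is
        required to be at least \<open>len D + 3\<close>.\<close>
      moreover have "len F \<le> len D + 3"
      proof -
        have "len l \<le> len (Imp (Conj (As q)) (Disj (Ls q)))" using len_Disj[OF 3(3)] by simp
        also have "\<dots> \<le> len D" unfolding D_def using 3(1) by (intro len_Disj) auto
        finally show ?thesis using 3(2) by simp
      qed
      ultimately show ?thesis using B by simp
    qed
  qed
  have tau: "pr (2 * B * (s + 2 * B * K + 3 * K) + s + K) (Imp (Imp (Conj (Es i)) (Disj (Ms i))) D)"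
    if i: "i < R" for i
  proof -
    have "len (Imp (Conj (Es i)) (Disj (Ms i))) \<le> len T"
      unfolding T_def using i by (intro len_Disj) auto
    then have len: "len (Conj (Es i)) \<le> B" "len (Disj (Ms i)) \<le> B" using B by auto
    have "pr (s + 2 * B * K + 2 * K) (Imp (Neg D) E)" if E: "E \<in> set (Es i)" for E
    proof -
      obtain F where F: "pr s (Imp F E)" "F = Const True \<or> (\<exists>q<Q. F \<in> set (As q) \<or> F \<in> Neg ` set (Ls q))"
        using Es[OF i E] unfolding s_def by blast
      have "len E \<le> B" using len_Conj[OF E] len by simp
      then show ?thesis
        by - (rule pr_by2[OF F(1) conjunct1[OF avail[OF F(2)]], where ps = "[D, F, E]" and B = B
              and \<sigma> = "Imp (Atom 1) (Atom 2)" and \<rho> = "Imp (Neg (Atom 0)) (Atom 1)"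
              and \<tau> = "Imp (Neg (Atom 0)) (Atom 2)"],
            use avail[OF F(2)] lenD B4 in \<open>auto simp: taut_def K_def\<close>)
    qed
    from pr_Conj_intro[of "Es i", OF this len(1) lenD(1)]
    have "pr ((length (Es i) + 1) * (s + 2 * B * K + 2 * K + K)) (Imp (Neg D) (Conj (Es i)))"
      by (simp add: K_def)
    moreover have "(length (Es i) + 1) * (s + 2 * B * K + 2 * K + K) \<le> 2 * B * (s + 2 * B * K + 3 * K)"
      using length_le_len_Conj[of "Es i"] len(1) B4 by (intro mult_le_mono) auto
    ultimately have C: "pr (2 * B * (s + 2 * B * K + 3 * K)) (Imp (Neg D) (Conj (Es i)))"
      by (rule pr_mono)
    show ?thesis
      by (rule pr_by2[OF C Ms[OF i, folded s_def], where ps = "[Conj (Es i), Disj (Ms i), D]" and B = B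
              and \<sigma> = "Imp (Neg (Atom 2)) (Atom 0)" and \<rho> = "Neg (Atom 1)"
              and \<tau> = "Imp (Imp (Atom 0) (Atom 1)) (Atom 2)"])
        (use len lenD B4 in \<open>auto simp: taut_def K_def\<close>)
  qed
  have "pr ((length (map (\<lambda>i. Imp (Conj (Es i)) (Disj (Ms i))) [0..<R]) + 1) *
      ((2 * B * (s + 2 * B * K + 3 * K) + s + K) + schema_const * B)) (Imp T D)"
    unfolding T_def using tau B(2) lenD(2) by (intro pr_Disj_elim) (auto simp: T_def)
  then show ?thesis
  proof (rule pr_mono)
    have "R \<le> B" using length_le_len_Disj[of "map (\<lambda>i. Imp (Conj (Es i)) (Disj (Ms i))) [0..<R]"] B(2)
      unfolding T_def by simp
    then have "R + 1 \<le> 2 * B" using B4 by simp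
    have KB: "K \<le> B * K" using B4 by simp
    have "2 * B * (s + 2 * B * K + 3 * K) + s + K + schema_const * B \<le> 2 * B * (s + 5 * (B * K)) + s + 2 * (B * K)"
    proof -
      have "2 * B * (s + 2 * B * K + 3 * K) \<le> 2 * B * (s + 5 * (B * K))"
        using KB by (intro mult_le_mono) linarith+
      then show ?thesis using KB unfolding K_def[symmetric] by linarith
    qed
    also have "\<dots> \<le> 2 * B * (s + 5 * (B * K)) + B * s + 2 * (B * (B * K))"
      using B4 by (intro add_mono mult_le_mono) auto
    also have "\<dots> = 3 * (B * s) + 12 * (B * (B * K))" by (simp add: algebra_simps)
    finally have "(R + 1) * (2 * B * (s + 2 * B * K + 3 * K) + s + K + schema_const * B)
        \<le> 2 * B * (3 * (B * s) + 12 * (B * (B * K)))"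
      using \<open>R + 1 \<le> 2 * B\<close> by (intro mult_le_mono)
    \<comment> \<open>As \<open>s\<close> is 1000 times \<open>B * K\<close>, the sum is
      \<open>2 * (3 * 1000 + 12)\<close> units of \<open>schema_const * B ^ 4\<close>.\<close>
    also have "\<dots> = 6024 * (schema_const * B ^ 4)" unfolding s_def K_def by (simp add: power4_eq_xxxx power2_eq_square algebra_simps)
    finally show "(length (map (\<lambda>i. Imp (Conj (Es i)) (Disj (Ms i))) [0..<R]) + 1) *
      ((2 * B * (s + 2 * B * K + 3 * K) + s + K) + schema_const * B) \<le> 10000 * schema_const * B ^ 4" by simp
  qed
qed

section \<open>Kleene evaluation of a gate of the circuit value function\<close>

lemma keval_rename: "keval \<rho> (rename f p) = keval (\<lambda>i. \<rho> (f i)) p"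
  by (induction p) auto

text \<open>Evaluating after a substitution amounts to evaluating the original formula under the
  merged assignment, so the substituted formulas are never simplified explicitly.\<close>

lemma keval_subst_const:
  "keval \<rho> (subst_const r p) = keval (\<lambda>x. case r x of None \<Rightarrow> \<rho> x | Some b \<Rightarrow> Some b) p"
  by (induction p) (auto split: option.splits)

lemma keval_total: "(\<And>x. x \<in> atoms p \<Longrightarrow> \<rho> x = Some (e x)) \<Longrightarrow> keval \<rho> p = Some (sem e p)"
  by (induction p) (auto simp: kand_def kor_def)

lemma kor_False [simp]: "kor x (Some False) = x" "kor (Some False) x = x"
  by (cases x; auto simp: kor_def)+

lemma kand_True [simp]: "kand x (Some True) = x" "kand (Some True) x = x"
  by (cases x; auto simp: kand_def)+

lemma kand_False [simp]: "kand x (Some False) = Some False" "kand (Some False) x = Some False"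
  by (auto simp: kand_def)

lemma keval_Disj_False: "(\<And>p. p \<in> set ps \<Longrightarrow> keval \<rho> p = Some False) \<Longrightarrow> keval \<rho> (Disj ps) = Some False"
  by (induction ps rule: Disj.induct) auto

lemma keval_Disj_single:
  assumes "i < length ps" "\<And>j. j < length ps \<Longrightarrow> j \<noteq> i \<Longrightarrow> keval \<rho> (ps ! j) = Some False"
  shows "keval \<rho> (Disj ps) = keval \<rho> (ps ! i)"
  using assms
proof (induction ps arbitrary: i rule: Disj.induct)
  case (3 p q ps)
  show ?case
  proof (cases i)
    case 0
    have "keval \<rho> (Disj (q # ps)) = Some False"
    proof (rule keval_Disj_False)
      fix x assume "x \<in> set (q # ps)"
      then obtain j where "j < length (q # ps)" "(q # ps) ! j = x" by (metis in_set_conv_nth)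
      with 3(3)[of "Suc j"] 0 show "keval \<rho> x = Some False" by auto
    qed
    then show ?thesis using 0 by simp
  next
    case (Suc i')
    have "keval \<rho> (Disj (q # ps)) = keval \<rho> ((q # ps) ! i')"
    proof (rule 3(1))
      show "keval \<rho> ((q # ps) ! j) = Some False" if "j < length (q # ps)" "j \<noteq> i'" for j
        using 3(3)[of "Suc j"] that Suc by simp
    qed (use 3(2) Suc in simp)
    moreover have "keval \<rho> p = Some False" using 3(3)[of 0] Suc by simp
    ultimately show ?thesis using Suc by simp
  qed
qed auto

text \<open>The pointer bits refute the address test of every index other than \<open>P\<close>, and
  \<open>False\<close> conjoined with an undefined wire is still \<open>False\<close>. Only the
  disjunct of \<open>P\<close> survives, whether or not its wire has a value.\<close>

lemma keval_selected:
  assumes P: "\<And>t. t < w \<Longrightarrow> \<eta> (pos + t) = Some (bit P t)" "P < N" "N \<le> 2 ^ w"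
  shows "keval \<eta> (selected a pos w N) = \<eta> (a + P)"
proof -
  let ?c = "\<lambda>i. Conj (map (\<lambda>t. lit (pos + t) (bit i t)) [0..<w])"
  have c: "keval \<eta> (?c i) = Some (i = P)" if "i < N" for i
  proof -
    have "keval \<eta> (?c i) = Some (sem (\<lambda>x. the (\<eta> x)) (?c i))"
      using P(1) by (intro keval_total) auto
    also have "sem (\<lambda>x. the (\<eta> x)) (?c i) \<longleftrightarrow> (\<forall>t<w. bit P t = bit i t)"
      using P(1) by auto
    also have "\<dots> \<longleftrightarrow> i = P"
    proof
      assume eq: "\<forall>t<w. bit P t = bit i t"
      \<comment> \<open>Addresses below \<open>N\<close> have no bits from position \<open>w\<close>
        on, so agreement on \<open>w\<close> bits is equality.\<close>
      have big: "\<not> bit x t" if "w \<le> t" "x < N" for x t :: nat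
      proof -
        have "x < 2 ^ t" using that P(3) by (meson less_le_trans one_le_numeral power_increasing)
        then show ?thesis by (simp add: bit_iff_odd)
      qed
      show "i = P" using eq big[of _ i] big[of _ P] that P(2) by (intro bit_eqI) (metis not_less)
    qed simp
    finally show ?thesis .
  qed
  have "keval \<eta> (selected a pos w N) = keval \<eta> (map (\<lambda>i. And (?c i) (Atom (a + i))) [0..<N] ! P)"
    unfolding selected_def using P(2) c by (intro keval_Disj_single) auto
  then show ?thesis using P(2) c by simp
qed

lemma keval_cv_gate:
  fixes a k j :: nat
  defines "pos \<equiv> j * cv_block a k" and "w \<equiv> cv_width a k"
  assumes b: "\<eta> pos = Some b0" "\<eta> (pos + 1) = Some b1"
    and P: "\<And>t. t < w \<Longrightarrow> \<eta> (pos + 2 + t) = Some (bit P t)" "P < k + 1 + j"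
    and Q: "\<And>t. t < w \<Longrightarrow> \<eta> (pos + 2 + w + t) = Some (bit Q t)" "Q < k + 1 + j"
    and N: "k + 1 + j \<le> 2 ^ w"
  shows "keval \<eta> (cv_gate a k j) =
    (if \<not> b0 then map_option Not (\<eta> (a + P))
     else if \<not> b1 then kand (\<eta> (a + P)) (\<eta> (a + Q)) else kor (\<eta> (a + P)) (\<eta> (a + Q)))"
  using keval_selected[where \<eta> = \<eta> and pos = "pos + 2", OF P N] keval_selected[where \<eta> = \<eta> and pos = "pos + 2 + w", OF Q N] b
  unfolding cv_gate_def Let_def pos_def[symmetric] w_def[symmetric] by simp

section \<open>Embedding a circuit into the circuit value function\<close>

text \<open>The parameter \<open>z\<close> is the address of the constant wire 0, and
  \<open>f\<close> readdresses the wires. There are no constant gates in a description: 1 is coded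
  as \<open>Neg\<close> of wire \<open>z\<close>, and 0 as its conjunction with itself.\<close>

fun gate_code :: "nat \<Rightarrow> (nat \<Rightarrow> nat) \<Rightarrow> fm \<Rightarrow> bool \<times> bool \<times> nat \<times> nat" where
  "gate_code z f (Const b) = (\<not> b, False, z, z)"
| "gate_code z f (Neg (Atom p)) = (False, False, f p, z)"
| "gate_code z f (And (Atom p) (Atom q)) = (True, False, f p, f q)"
| "gate_code z f (Or (Atom p) (Atom q)) = (True, True, f p, f q)"
| "gate_code z f _ = (True, False, z, z)"

lemma kand_idem [simp]: "kand x x = x"
  by (cases x) (auto simp: kand_def)

lemma subst_const_Conj [simp]: "subst_const r (Conj ps) = Conj (map (subst_const r) ps)"
  by (induction ps rule: Conj.induct) auto

lemma subst_const_Disj [simp]: "subst_const r (Disj ps) = Disj (map (subst_const r) ps)"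
  by (induction ps rule: Disj.induct) auto

lemma len_subst_const: "len (subst_const r p) \<le> len p"
proof (induction p)
  case (Atom i)
  then show ?case using len_ge_4[of "Atom i"] by (auto split: option.splits)
qed auto

lemma len_atom_le: "x \<in> atoms p \<Longrightarrow> len (Atom x) \<le> len p"
  by (induction p) auto

lemma card_atoms_elementary: "elementary p \<Longrightarrow> card (atoms p) \<le> 2"
  by (elim elementary.elims) (auto simp: card_insert_if)

text \<open>The assumption \<open>fits\<close> reserves a gate for every gate of \<open>C\<close>
  and a separate copying gate for each of the \<open>k + 1\<close> outputs, so that no output wire
  is at the same time a wire of \<open>C\<close>.\<close>

locale padded_circuit =
  fixes k n :: nat and C :: circuit
  assumes wf: "wf_circuit C"
    and elem: "\<And>p. p \<in> set (gates C) \<Longrightarrow> elementary p"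
    and ins_C: "ins C = n"
    and n_le: "n \<le> k"
    and outs_C: "n < length (outs C)"
    and fits: "length (gates C) + k + 1 \<le> cv_gates (k\<^sup>2) k"
begin

abbreviation "l \<equiv> k\<^sup>2"
abbreviation "t \<equiv> cv_gates (k\<^sup>2) k"
abbreviation "w \<equiv> cv_width (k\<^sup>2) k"
abbreviation "blk \<equiv> cv_block (k\<^sup>2) k"
abbreviation "N \<equiv> length (gates C)"
abbreviation "F \<equiv> cv_circuit (k\<^sup>2) k"
abbreviation "G \<equiv> gad_circuit (k\<^sup>2) k (cv_circuit (k\<^sup>2) k)"

text \<open>The described circuit computes \<open>(x, z) \<mapsto> (y, z)\<close> where \<open>y\<close> consists of the first \<open>n + 1\<close>
  output bits of \<open>C x\<close>. Its gates are those of \<open>C\<close>, then idle gates, then copies of the wires that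
  are to be the outputs.\<close>

definition emb :: "nat \<Rightarrow> nat" where
  "emb p = (if p < n then p else k + 1 + (p - n))"

text \<open>A conjunction of \<open>p\<close> with itself copies \<open>p\<close>, and on the
  constant wire \<open>k\<close> it is an idle gate of value 0. The shift in \<open>o' - 1\<close>
  arises because \<open>n + 1\<close> outputs take the place of \<open>n\<close> inputs: output
  \<open>o' > n\<close> repeats input \<open>o' - 1\<close>.\<close>

definition gate_descr :: "nat \<Rightarrow> bool \<times> bool \<times> nat \<times> nat" where
  "gate_descr j = (if j < N then gate_code k emb (gates C ! j)
     else if j + (k + 1) < t then (True, False, k, k)
     else let o' = j + (k + 1) - t; p = (if o' \<le> n then emb (outs C ! o') else o' - 1)
          in (True, False, p, p))"

text \<open>The bits are laid out as \<open>cv_gate\<close> reads them. Positions after the last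
  full block receive a value as well, so that \<open>v\<close> becomes constant throughout.\<close>

definition descr :: "nat \<Rightarrow> bool" where
  "descr x = (case gate_descr (x div blk) of (b0, b1, P, Q) \<Rightarrow>
     let y = x mod blk in
     if y = 0 then b0 else if y = 1 then b1
     else if y < 2 + w then bit P (y - 2) else bit Q (y - 2 - w))"

text \<open>The constants substituted for the wires of one copy of the described circuit, where \<open>\<beta>\<close> is the
  block of the target string for that copy; \<open>None\<close> marks the wires of \<open>C\<close>.\<close>

definition wire_value :: "(nat \<Rightarrow> bool) \<Rightarrow> nat \<Rightarrow> bool option" where
  "wire_value \<beta> p = (if p < n then None else if p < k then Some (\<beta> (p + 1))
     else if p = k then Some False else if p < k + 1 + N then None
     else if p < t then Some False else Some (\<beta> (p - t)))"

lemma wire_value_emb: "p < n + N \<Longrightarrow> wire_value \<beta> (emb p) = None"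
  using n_le by (auto simp: wire_value_def emb_def)

lemma emb_less: "p < n + j \<Longrightarrow> emb p < k + 1 + j"
  using n_le by (auto simp: emb_def)

lemma outs_less:
  assumes "o' \<le> n"
  shows "outs C ! o' < n + N"
proof -
  have "outs C ! o' \<in> set (outs C)" using assms outs_C by (intro nth_mem) simp
  then show ?thesis using wf by (auto simp: wf_circuit_def wires_def ins_C)
qed

lemma inj_emb: "inj emb"
  using n_le by (auto simp: inj_def emb_def split: if_splits)

lemma block_le: "j < t \<Longrightarrow> j * blk + blk \<le> l"
proof -
  assume "j < t"
  then have "(j + 1) * blk \<le> t * blk" by (intro mult_le_mono1) simp
  also have "\<dots> \<le> l" by (simp add: cv_gates_def)
  finally show ?thesis by simp
qed

lemma addressable: "j < t \<Longrightarrow> k + 1 + j \<le> 2 ^ w"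
proof -
  assume j: "j < t"
  have "j < l" using block_le[OF j] by (auto simp: cv_block_def intro: less_le_trans[of _ "j * blk + blk"])
  moreover from this have "k + l < 2 ^ w" unfolding cv_width_def by (intro floorlog_leD) auto
  ultimately show ?thesis by simp
qed

lemma descr_block:
  assumes "gate_descr j = (b0, b1, P, Q)"
  shows "descr (j * blk) = b0" "descr (j * blk + 1) = b1"
    "i < w \<Longrightarrow> descr (j * blk + 2 + i) = bit P i"
    "i < w \<Longrightarrow> descr (j * blk + 2 + w + i) = bit Q i"
proof -
  have *: "(j * blk + y) div blk = j \<and> (j * blk + y) mod blk = y" if "y < blk" for y
    using that by simp
  have "0 < blk" "1 < blk" "i < w \<Longrightarrow> 2 + i < blk" "i < w \<Longrightarrow> 2 + w + i < blk"
    by (auto simp: cv_block_def)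
  note this[THEN *]
  with assms show "descr (j * blk) = b0" "descr (j * blk + 1) = b1"
    "i < w \<Longrightarrow> descr (j * blk + 2 + i) = bit P i"
    "i < w \<Longrightarrow> descr (j * blk + 2 + w + i) = bit Q i"
    by (simp_all add: descr_def Let_def add.assoc)
qed

text \<open>A pointer to a wire that is not earlier would select nothing. Gates of \<open>C\<close>
  read earlier wires and \<open>emb\<close> preserves this; copying gates come after all gates of
  \<open>C\<close> and may read any of its wires.\<close>

lemma gate_descr_bounded:
  assumes "j < t" "gate_descr j = (b0, b1, P, Q)"
  shows "P < k + 1 + j" "Q < k + 1 + j"
proof -
  have "P < k + 1 + j \<and> Q < k + 1 + j"
  proof (cases "j < N")
    case True
    then have at: "atoms (gates C ! j) \<subseteq> {..<n + j}" and el: "elementary (gates C ! j)"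
      using wf elem by (auto simp: wf_circuit_def ins_C)
    show ?thesis
      using assms(2) True el at emb_less[of _ j] by (cases "gates C ! j" rule: elementary.cases) (auto simp: gate_descr_def)
  next
    case False
    have "emb (outs C ! o') < k + 1 + j" if "o' \<le> n" for o'
      using emb_less[of "outs C ! o'" j] outs_less[OF that] False by simp
    then show ?thesis
      using assms False by (auto simp: gate_descr_def Let_def split: if_splits)
  qed
  then show "P < k + 1 + j" "Q < k + 1 + j" by auto
qed

text \<open>Here \<rho> holds the possibly undefined values of the wires of \<open>C\<close>. With
  the bits of \<open>v\<close> fixed, a gate reads only the wires \<open>P\<close> and
  \<open>Q\<close>, so its value is that of the gate of \<open>C\<close>, of the idle gate or of the
  copied wire.\<close>

lemma keval_gate:
  assumes v: "\<And>x. x < l \<Longrightarrow> \<eta> x = Some (descr x)"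
    and u: "\<And>p. p < k + 1 + t \<Longrightarrow> \<eta> (l + p) = (case wire_value \<beta> p of None \<Rightarrow> \<rho> p | Some b \<Rightarrow> Some b)"
    and j: "j < t"
  shows "keval \<eta> (cv_gate l k j) =
    (if j < N then keval (\<lambda>p. \<rho> (emb p)) (gates C ! j)
     else if j + (k + 1) < t then Some False
     else let o' = j + (k + 1) - t in
       if o' \<le> n then \<rho> (emb (outs C ! o')) else Some (\<beta> o'))"
proof -
  obtain b0 b1 P Q where c: "gate_descr j = (b0, b1, P, Q)" by (metis prod_cases4)
  have pos: "j * blk + (2 + w + w) \<le> l" using block_le[OF j] by (simp add: cv_block_def)
  note PQ = gate_descr_bounded[OF j c]
  have gate: "keval \<eta> (cv_gate l k j) =
    (if \<not> b0 then map_option Not (\<eta> (l + P))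
     else if \<not> b1 then kand (\<eta> (l + P)) (\<eta> (l + Q)) else kor (\<eta> (l + P)) (\<eta> (l + Q)))"
    using pos descr_block[OF c] PQ addressable[OF j] by (intro keval_cv_gate) (auto simp: v)
  have uk: "\<eta> (l + k) = Some False" using u[of k] n_le by (simp add: wire_value_def)
  have ue: "\<eta> (l + emb p) = \<rho> (emb p)" if "p < n + N" for p
    using u[of "emb p"] emb_less[OF that] wire_value_emb[OF that] fits by simp
  show ?thesis
  proof (cases "j < N")
    case True
    then have at: "atoms (gates C ! j) \<subseteq> {..<n + j}" and el: "elementary (gates C ! j)"
      using wf elem by (auto simp: wf_circuit_def ins_C)
    show ?thesis
      using c True el at uk ue gate
      by (cases "gates C ! j" rule: elementary.cases) (auto simp: gate_descr_def)
  next
    case False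
    show ?thesis
    proof (cases "j + (k + 1) < t")
      case True
      then show ?thesis using c False gate uk by (auto simp: gate_descr_def)
    next
      case nt: False
      define o' where "o' = j + (k + 1) - t"
      have o': "o' \<le> k" using j by (simp add: o'_def)
      show ?thesis
      proof (cases "o' \<le> n")
        case True
        show ?thesis using c False nt True gate ue outs_less[OF True]
          by (auto simp: gate_descr_def Let_def o'_def)
      next
        case no: False
        \<comment> \<open>Wire \<open>o' - 1\<close> is an input of the part \<open>z\<close>,
          chosen to be exactly the target bit of output \<open>o'\<close>.\<close>
        have "\<eta> (l + (o' - 1)) = Some (\<beta> o')"
          using u[of "o' - 1"] no o' by (auto simp: wire_value_def)
        then show ?thesis using c False nt no gate
          by (auto simp: gate_descr_def Let_def o'_def)
      qed
    qed
  qed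
qed

lemma gates_F: "gates F = Const False # map (cv_gate l k) [0..<t]" "length (gates F) = t + 1" "ins F = l + k"
  by (simp_all add: cv_circuit_def)

text \<open>This is where outputs become premises. The wire of a copying gate has been replaced by
  the target bit, so its equation fixes an output wire of \<open>C\<close>; that is a negated output
  literal. All other equations are gate equations of \<open>C\<close> or hold outright.\<close>

lemma local_implication:
  assumes r_v: "\<And>x. x < l \<Longrightarrow> r (\<mu> x) = Some (descr x)"
    and r_u: "\<And>p. p < k + 1 + t \<Longrightarrow> r (\<mu> (l + p)) = wire_value \<beta> p"
    and j: "j < t + 1"
  defines "E \<equiv> subst_const r (Iff (Atom (\<mu> (l + k + j))) (rename \<mu> (gates F ! j)))"
    and "\<nu> \<equiv> \<lambda>p. \<mu> (l + emb p)"
  shows "\<exists>H. (H = Const True \<or> (\<exists>j<N. H = Iff (Atom (\<nu> (n + j))) (rename \<nu> (gates C ! j))) \<or>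
      (\<exists>o'\<le>n. H = Neg (lit (\<nu> (outs C ! o')) (\<not> \<beta> o')))) \<and>
    (\<forall>B. len (Imp H E) \<le> B \<longrightarrow> pr (1000 * schema_const * B\<^sup>2) (Imp H E))"
proof -
  \<comment> \<open>The assignment \<eta> reads a wire through the substitution and otherwise
    through \<open>e\<close> on the atoms in \<open>X\<close>; \<rho> is its part for wires that
    remain atoms.\<close>
  define \<eta> where "\<eta> e X = (\<lambda>x. case r (\<mu> x) of Some b \<Rightarrow> Some b
     | None \<Rightarrow> (if \<mu> x \<in> X then Some (e (\<mu> x)) else None))"
    for e :: "nat \<Rightarrow> bool" and X
  define \<rho> where "\<rho> e X = (\<lambda>p. (if \<mu> (l + p) \<in> X then Some (e (\<mu> (l + p))) else None))"
    for e :: "nat \<Rightarrow> bool" and X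
  have v: "\<eta> e X x = Some (descr x)" if "x < l" for e X x using r_v[OF that] by (simp add: \<eta>_def)
  have u: "\<eta> e X (l + p) = (case wire_value \<beta> p of None \<Rightarrow> \<rho> e X p | Some b \<Rightarrow> Some b)"
    if "p < k + 1 + t" for e X p
    using r_u[OF that] by (simp add: \<eta>_def \<rho>_def split: option.splits)
  have gate: "keval (\<eta> e X) (cv_gate l k i) =
    (if i < N then keval (\<lambda>p. \<rho> e X (emb p)) (gates C ! i)
     else if i + (k + 1) < t then Some False
     else let o' = i + (k + 1) - t in
       if o' \<le> n then \<rho> e X (emb (outs C ! o')) else Some (\<beta> o'))" if "i < t" for e X i
    by (rule keval_gate[OF v u that])
  have E: "keval (\<lambda>x. if x \<in> X then Some (e x) else None) E =
      keval (\<eta> e X) (Iff (Atom (l + k + j)) (gates F ! j))" for e X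
    unfolding E_def keval_subst_const Iff_def keval.simps keval_rename
    by (simp add: \<eta>_def keval_rename keval_subst_const cong: option.case_cong)
  have \<nu>_emb: "\<mu> (l + emb p) = \<nu> p" for p by (simp add: \<nu>_def)
  \<comment> \<open>If \<open>e\<close> falsifies \<open>H\<close>, the implication is true whatever
    \<open>E\<close> is; otherwise the atoms of \<open>H\<close> alone must determine
    \<open>E\<close> to be true.\<close>
  have suffices: ?thesis
    if H: "H = Const True \<or> (\<exists>j<N. H = Iff (Atom (\<nu> (n + j))) (rename \<nu> (gates C ! j))) \<or>
      (\<exists>o'\<le>n. H = Neg (lit (\<nu> (outs C ! o')) (\<not> \<beta> o')))"
      and c: "card (atoms H) \<le> 3"
      and val: "\<And>e. sem e H \<Longrightarrow> keval (\<eta> e (atoms H)) (Iff (Atom (l + k + j)) (gates F ! j)) = Some True"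
    for H
  proof (intro exI conjI allI impI)
    fix B assume B: "len (Imp H E) \<le> B"
    show "pr (1000 * schema_const * B\<^sup>2) (Imp H E)"
    proof (rule pr_local[OF finite_atoms c])
      show "len (Atom x) \<le> B" if "x \<in> atoms H" for x
        using len_atom_le[OF that] B by simp
      fix e :: "nat \<Rightarrow> bool"
      let ?\<rho> = "\<lambda>x. if x \<in> atoms H then Some (e x) else None"
      have "keval ?\<rho> H = Some (sem e H)" by (rule keval_total) simp
      then show "keval ?\<rho> (Imp H E) = Some True"
        using val[of e] E[of "atoms H" e] by (cases "sem e H") (auto simp: kor_def)
    qed (fact B)
  qed (fact H)
  have iff: "keval \<rho>' (Iff p q) = Some True" if "keval \<rho>' p = Some b" "keval \<rho>' q = Some b" for \<rho>' p q b
    using that by (cases b) (auto simp: Iff_def kand_def kor_def)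
  show ?thesis
  proof (cases j)
    case 0
    have "keval (\<eta> e X) (Iff (Atom (l + k + j)) (gates F ! j)) = Some True" for e X
      using u[of k e X] n_le by (intro iff[of _ _ False]) (auto simp: 0 gates_F wire_value_def)
    then show ?thesis by (intro suffices[of "Const True"]) auto
  next
    case (Suc j')
    with j have j': "j' < t" by simp
    have lhs: "keval (\<eta> e X) (Atom (l + k + j)) =
        (case wire_value \<beta> (k + 1 + j') of None \<Rightarrow> \<rho> e X (k + 1 + j') | Some b \<Rightarrow> Some b)" for e X
      using u[of "k + 1 + j'" e X] j' by (simp add: Suc add_ac)
    have rhs: "keval (\<eta> e X) (gates F ! j) = keval (\<eta> e X) (cv_gate l k j')" for e X
      using j' by (simp add: Suc gates_F)
    \<comment> \<open>The cases are gates of \<open>C\<close>, idle gates, copies of outputs of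
      \<open>C\<close> and copies of inputs. Only the first and the third need a premise
      \<open>H\<close>.\<close>
    consider "j' < N" | "\<not> j' < N" "j' + (k + 1) < t" | "\<not> j' < N" "\<not> j' + (k + 1) < t" "j' + (k + 1) - t \<le> n"
      | "\<not> j' < N" "\<not> j' + (k + 1) < t" "\<not> j' + (k + 1) - t \<le> n" by blast
    then show ?thesis
    proof cases
      case 1
      have \<nu>_j: "\<mu> (l + (k + 1 + j')) = \<nu> (n + j')" by (simp add: \<nu>_def emb_def)
      let ?H = "Iff (Atom (\<nu> (n + j'))) (rename \<nu> (gates C ! j'))"
      have at: "atoms ?H = insert (\<nu> (n + j')) (\<nu> ` atoms (gates C ! j'))"
        by (auto simp: Iff_def atoms_rename)
      have "card (\<nu> ` atoms (gates C ! j')) \<le> 2"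
        using card_image_le[of "atoms (gates C ! j')" \<nu>] card_atoms_elementary[OF elem, of "gates C ! j'"] 1 by simp
      then have c: "card (atoms ?H) \<le> 3" unfolding at by (auto simp: card_insert_if)
      have "keval (\<eta> e (atoms ?H)) (Iff (Atom (l + k + j)) (gates F ! j)) = Some True" if "sem e ?H" for e
      proof (rule iff)
        have "wire_value \<beta> (k + 1 + j') = None" using 1 wire_value_emb[of "n + j'" \<beta>] by (simp add: emb_def)
        then show "keval (\<eta> e (atoms ?H)) (Atom (l + k + j)) = Some (e (\<nu> (n + j')))"
          unfolding lhs \<rho>_def \<nu>_j by (simp add: at)
        have "keval (\<eta> e (atoms ?H)) (gates F ! j) = keval (\<lambda>p. \<rho> e (atoms ?H) (emb p)) (gates C ! j')"
          unfolding rhs using gate[OF j', of e "atoms ?H"] 1 by simp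
        also have "\<dots> = Some (sem (\<lambda>p. e (\<nu> p)) (gates C ! j'))"
          by (rule keval_total) (auto simp: at \<rho>_def \<nu>_emb)
        also have "sem (\<lambda>p. e (\<nu> p)) (gates C ! j') = e (\<nu> (n + j'))"
          using that by (auto simp: Iff_def sem_rename)
        finally show "keval (\<eta> e (atoms ?H)) (gates F ! j) = Some (e (\<nu> (n + j')))" .
      qed
      then show ?thesis using 1 c by (intro suffices[of ?H]) auto
    next
      case 2
      have "wire_value \<beta> (k + 1 + j') = Some False" using 2 n_le by (simp add: wire_value_def)
      then have "keval (\<eta> e X) (Iff (Atom (l + k + j)) (gates F ! j)) = Some True" for e X
        using lhs rhs gate[OF j', of e X] 2 by (intro iff[of _ _ False]) auto
      then show ?thesis by (intro suffices[of "Const True"]) auto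
    next
      case 3
      let ?o = "j' + (k + 1) - t"
      let ?H = "Neg (lit (\<nu> (outs C ! ?o)) (\<not> \<beta> ?o))"
      have wv: "wire_value \<beta> (k + 1 + j') = Some (\<beta> ?o)" using 3 n_le by (auto simp: wire_value_def add_ac)
      have "keval (\<eta> e (atoms ?H)) (Iff (Atom (l + k + j)) (gates F ! j)) = Some True" if "sem e ?H" for e
      proof (rule iff)
        show "keval (\<eta> e (atoms ?H)) (Atom (l + k + j)) = Some (\<beta> ?o)" unfolding lhs wv by simp
        have "keval (\<eta> e (atoms ?H)) (gates F ! j) = \<rho> e (atoms ?H) (emb (outs C ! ?o))"
          unfolding rhs using gate[OF j', of e "atoms ?H"] 3 by (simp add: Let_def)
        also have "\<dots> = Some (\<beta> ?o)" using that by (simp add: \<rho>_def \<nu>_emb)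
        finally show "keval (\<eta> e (atoms ?H)) (gates F ! j) = Some (\<beta> ?o)" .
      qed
      then show ?thesis using 3 by (intro suffices[of ?H]) auto
    next
      case 4
      let ?o = "j' + (k + 1) - t"
      have "wire_value \<beta> (k + 1 + j') = Some (\<beta> ?o)" using 4 n_le by (auto simp: wire_value_def add_ac)
      then have "keval (\<eta> e X) (Iff (Atom (l + k + j)) (gates F ! j)) = Some True" for e X
        using lhs rhs gate[OF j', of e X] 4 by (intro iff[of _ _ "\<beta> ?o"]) (auto simp: Let_def)
      then show ?thesis by (intro suffices[of "Const True"]) auto
    qed
  qed
qed

end

text \<open>Atoms may have arbitrarily large indices, so the number of nodes alone does not bound
  the code length; the longest atom code enters as a factor.\<close>

lemma len_le_fsize: "(\<And>x. x \<in> atoms p \<Longrightarrow> len (Atom x) \<le> B) \<Longrightarrow> 4 \<le> B \<Longrightarrow> len p \<le> fsize p * B"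
proof (induction p)
  case (Neg p)
  then have "len p \<le> fsize p * B" by simp
  then show ?case using Neg.prems by simp
next
  case (And p q)
  then have "len p \<le> fsize p * B" "len q \<le> fsize q * B" by simp_all
  then show ?case using And.prems by (simp add: add_mult_distrib)
next
  case (Or p q)
  then have "len p \<le> fsize p * B" "len q \<le> fsize q * B" by simp_all
  then show ?case using Or.prems by (simp add: add_mult_distrib)
next
  case (Imp p q)
  then have "len p \<le> fsize p * B" "len q \<le> fsize q * B" by simp_all
  then show ?case using Imp.prems by (simp add: add_mult_distrib)
qed auto

lemma fsize_rename [simp]: "fsize (rename f p) = fsize p"
  by (induction p) auto

lemma fsize_Conj: "fsize (Conj ps) \<le> sum_list (map (\<lambda>p. fsize p + 1) ps) + 1"
  by (induction ps rule: Conj.induct) auto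

lemma fsize_Disj: "fsize (Disj ps) \<le> sum_list (map (\<lambda>p. fsize p + 1) ps) + 1"
  by (induction ps rule: Disj.induct) auto

lemma fsize_tau: "fsize (tau C b \<nu>) \<le> 8 * csize C + 3"
proof -
  have 1: "sum_list (map (\<lambda>j. fsize (Iff (Atom (\<nu> (ins C + j))) (rename \<nu> (gates C ! j))) + 1) [0..<length (gates C)])
      \<le> sum_list (map (\<lambda>j. 8 * fsize (gates C ! j)) [0..<length (gates C)])"
  proof (rule sum_list_mono)
    fix j
    \<comment> \<open>For a gate of size \<open>f\<close> the left side is \<open>2 * f + 6\<close>,
      and \<open>f \<ge> 1\<close>.\<close>
    show "fsize (Iff (Atom (\<nu> (ins C + j))) (rename \<nu> (gates C ! j))) + 1 \<le> 8 * fsize (gates C ! j)"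
      using fsize_pos[of "gates C ! j"] unfolding Iff_def fsize.simps fsize_rename by linarith
  qed
  have "map (\<lambda>j. fsize (gates C ! j)) [0..<length (gates C)] = map fsize (gates C)"
    by (rule nth_equalityI) auto
  then have 2: "sum_list (map (\<lambda>j. 8 * fsize (gates C ! j)) [0..<length (gates C)]) = 8 * sum_list (map fsize (gates C))"
    using sum_list_const_mult[of 8 "\<lambda>j. fsize (gates C ! j)" "[0..<length (gates C)]"] by simp
  have 3: "sum_list (map (\<lambda>i. fsize (lit (\<nu> (outs C ! i)) (\<not> b ! i)) + 1) [0..<length (outs C)])
      \<le> sum_list (map (\<lambda>i. 3) [0..<length (outs C)])"
    by (rule sum_list_mono) (simp add: lit_def)
  show ?thesis
    using fsize_Conj[of "map (\<lambda>j. Iff (Atom (\<nu> (ins C + j))) (rename \<nu> (gates C ! j))) [0..<length (gates C)]"]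
      fsize_Disj[of "map (\<lambda>i. lit (\<nu> (outs C ! i)) (\<not> b ! i)) [0..<length (outs C)]"] 1 2 3
    unfolding tau_def csize_def by (simp add: comp_def sum_list_triv)
qed

section \<open>From disjunctions for the gadget generator to disjunctions for
  \<open>C\<close>\<close>

context padded_circuit
begin

text \<open>A left inverse of \<open>gad_wire\<close>: the copy and the wire of the described circuit.\<close>

definition wire_of :: "nat \<Rightarrow> nat \<times> nat" where
  "wire_of x = (if x < l + k * (l + 1) then ((x - l) div k, (x - l) mod k)
     else ((x - (l + k * (l + 1))) div (t + 1), k + (x - (l + k * (l + 1))) mod (t + 1)))"

lemma wire_of_gad_wire:
  assumes "s \<le> l" "p < k + 1 + t"
  shows "wire_of (gad_wire l k F s (l + p)) = (s, p)"
proof (cases "p < k")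
  case True
  then have "s * k + p < (s + 1) * k" by simp
  also have "\<dots> \<le> (l + 1) * k" using assms by (intro mult_le_mono1) simp
  finally have "l + (s * k + p) < l + k * (l + 1)" by (simp add: mult.commute)
  then show ?thesis using True by (simp add: wire_of_def gad_wire_def add.assoc del: mult_Suc_right)
next
  case False
  then obtain y where y: "p = k + y" by (metis le_Suc_ex not_less)
  define T A where "T = t + 1" and "A = l + k * (l + 1)"
  have "y < T" using assms(2) y by (simp add: T_def)
  then have "(s * T + y) div T = s" "(s * T + y) mod T = y" by auto
  moreover have "gad_wire l k F s (l + p) = A + (s * T + y)"
    unfolding gad_wire_def y gates_F(2) T_def[symmetric] A_def[symmetric] by simp
  ultimately show ?thesis
    unfolding wire_of_def T_def[symmetric] A_def[symmetric] y by simp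
qed

lemma gad_wire_bounds:
  assumes "s \<le> l" "p < k + 1 + t"
  shows "l \<le> gad_wire l k F s (l + p)" "gad_wire l k F s (l + p) < wires G"
proof -
  show "l \<le> gad_wire l k F s (l + p)" by (simp add: gad_wire_def)
  have "gad_wire l k F s (l + p) < l + k * (l + 1) + (s * (t + 1) + (t + 1))"
    using gad_wire_less[of "l + p" l k "t + 1" F s] assms by (simp add: gates_F add_ac)
  also have "s * (t + 1) + (t + 1) = (s + 1) * (t + 1)" by simp
  also have "\<dots> \<le> (l + 1) * (t + 1)" using assms by (intro mult_le_mono1) simp
  also have "l + k * (l + 1) + (l + 1) * (t + 1) = wires G"
    using length_concat_uniform[of "l + 1" "\<lambda>s. map (rename (gad_wire l k F s)) (gates F)" "t + 1"]
    by (simp add: wires_def gad_circuit_def gates_F del: mult_Suc_right mult_Suc upt_Suc)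
  finally show "gad_wire l k F s (l + p) < wires G" by simp
qed

lemma length_gates_G: "length (gates G) = (l + 1) * (t + 1)"
  unfolding gad_circuit_def circuit.sel by (rule length_concat_uniform) (simp add: gates_F)

lemma gate_G:
  assumes "s \<le> l" "j < t + 1"
  shows "gates G ! (s * (t + 1) + j) = rename (gad_wire l k F s) (gates F ! j)"
    "ins G + (s * (t + 1) + j) = gad_wire l k F s (l + k + j)"
proof -
  have "gates G ! (s * (t + 1) + j) = map (rename (gad_wire l k F s)) (gates F) ! j"
    unfolding gad_circuit_def circuit.sel using assms by (intro nth_concat_uniform) (auto simp: gates_F)
  then show "gates G ! (s * (t + 1) + j) = rename (gad_wire l k F s) (gates F ! j)"
    using assms gates_F(2) by simp
  show "ins G + (s * (t + 1) + j) = gad_wire l k F s (l + k + j)"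
    using gates_F(2) by (simp add: gad_wire_def gad_circuit_def)
qed

lemma outs_G:
  shows "length (outs G) = (l + 1) * (k + 1)"
    and "s \<le> l \<Longrightarrow> i \<le> k \<Longrightarrow> outs G ! (s * (k + 1) + i) = gad_wire l k F s (l + (t + i))"
proof -
  show "length (outs G) = (l + 1) * (k + 1)"
    unfolding gad_circuit_def circuit.sel by (rule length_concat_uniform) (simp add: cv_circuit_def)
  assume si: "s \<le> l" "i \<le> k"
  then have "outs G ! (s * (k + 1) + i) = map (gad_wire l k F s) (outs F) ! i"
    unfolding gad_circuit_def circuit.sel by (intro nth_concat_uniform) (auto simp: cv_circuit_def)
  also have "\<dots> = gad_wire l k F s (l + (t + i))" using si by (simp add: cv_circuit_def add.assoc del: upt_Suc)
  finally show "outs G ! (s * (k + 1) + i) = gad_wire l k F s (l + (t + i))" .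
qed

lemma split_index:
  assumes "x < (l + 1) * m"
  obtains s j where "s \<le> l" "j < m" "x = s * m + j"
proof -
  have "0 < m" using assms by (cases m) auto
  moreover have "x div m < l + 1" using assms by (simp add: less_mult_imp_div_less)
  ultimately show ?thesis by (intro that[of "x div m" "x mod m"]) auto
qed

text \<open>The atoms of the new disjunction thus already occur in the old one, so their codes are
  no longer than it. Input wires need an argument: they occur because the first described gate
  offers every input for selection.\<close>

lemma atom_in_tau_G:
  assumes "s \<le> l" "p < k + 1 + t"
  shows "\<nu> (gad_wire l k F s (l + p)) \<in> atoms (tau G b \<nu>)"
proof -
  have *: "atoms (Iff (Atom (\<nu> (ins G + (s * (t + 1) + j)))) (rename \<nu> (gates G ! (s * (t + 1) + j))))
      \<subseteq> atoms (tau G b \<nu>)" if "j < t + 1" for j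
  proof -
    have "(s + 1) * (t + 1) \<le> (l + 1) * (t + 1)" using assms by (intro mult_le_mono1) simp
    then have "s * (t + 1) + j < length (gates G)" using that by (simp add: length_gates_G)
    then show ?thesis unfolding tau_def by (auto simp del: add_Suc_right mult_Suc_right)
  qed
  show ?thesis
  proof (cases "p < k")
    case False
    then have "gad_wire l k F s (l + p) = ins G + (s * (t + 1) + (p - k))"
      using gate_G(2)[of s "p - k"] assms by simp
    moreover have "\<nu> (ins G + (s * (t + 1) + (p - k))) \<in> atoms (tau G b \<nu>)"
      using *[of "p - k"] assms False by (auto simp: Iff_def)
    ultimately show ?thesis by simp
  next
    case True
    have t: "1 < t + 1" using fits by simp
    have "gates F ! 1 = cv_gate l k 0" using t by (simp add: gates_F)
    moreover have "l + p \<in> atoms (cv_gate l k 0)"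
      using True by (auto simp: cv_gate_def Let_def selected_def)
    ultimately have "\<nu> (gad_wire l k F s (l + p)) \<in> atoms (rename \<nu> (gates G ! (s * (t + 1) + 1)))"
      unfolding gate_G(1)[OF assms(1) t] by (auto simp: atoms_rename)
    then show ?thesis using *[OF t] by (auto simp: Iff_def)
  qed
qed

text \<open>Disjunct \<open>q = i * (l + 1) + s\<close> of \<open>D'\<close> stems from copy
  \<open>s\<close> inside disjunct \<open>i\<close> of \<open>D\<close>. Copies inside one disjunct
  share only the wires of \<open>v\<close>, which all become constants; so the atoms that remain are
  distinct, as \<open>tau_disjunctions\<close> demands.\<close>

lemma reduction:
  assumes "D \<in> tau_disjunctions G"
  shows "\<exists>r D'. D' \<in> tau_disjunctions C \<and> len D' \<le> (len D * (l + 1) * (8 * csize C + 4) + 1) * len D \<and>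
    (\<forall>B. len D + len D' + 9 \<le> B \<longrightarrow> pr (10000 * schema_const * B ^ 4) (Imp (subst_const r D) D'))"
proof -
  obtain bs \<nu> where D: "D = Disj (map (\<lambda>i. tau G (bs ! i) (\<nu> i)) [0..<length bs])"
    and bs: "bs \<noteq> []" "\<forall>b\<in>set bs. length b = length (outs G)"
    and inj: "inj_on (\<lambda>(i, w). \<nu> i w) ({..<length bs} \<times> {..<wires G})"
    using assms unfolding tau_disjunctions_def by blast
  define R where "R = length bs"
  define \<mu> where "\<mu> i s x = \<nu> i (gad_wire l k F s x)" for i s x
  define \<beta> where "\<beta> i s o' = bs ! i ! (s * (k + 1) + o')" for i s o'
  define val where "val = (\<lambda>(i, x). if x < l then Some (descr x)
     else wire_value (\<beta> i (fst (wire_of x))) (snd (wire_of x)))"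
  \<comment> \<open>The substitution acts on atoms but is specified on wires; joint injectivity of
    \<nu> recovers the disjunct and the wire from an atom of \<open>D\<close>.\<close>
  define r where "r = (\<lambda>a. val (inv_into ({..<R} \<times> {..<wires G}) (\<lambda>(i, w). \<nu> i w) a))"
  have r: "r (\<nu> i x) = val (i, x)" if "i < R" "x < wires G" for i x
    using inv_into_f_f[OF inj, of "(i, x)"] that by (simp add: r_def R_def)
  have l_less: "x < wires G" if "x < l" for x
    using that by (simp add: wires_def gad_circuit_def)
  have r_v: "r (\<mu> i s x) = Some (descr x)" if "i < R" "x < l" for i s x
    using r[OF that(1) l_less[OF that(2)]] that by (simp add: \<mu>_def gad_wire_def val_def)
  have r_u: "r (\<mu> i s (l + p)) = wire_value (\<beta> i s) p" if "i < R" "s \<le> l" "p < k + 1 + t" for i s p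
    using r[OF that(1) gad_wire_bounds(2)[OF that(2,3)]] gad_wire_bounds(1)[OF that(2,3)]
    by (simp add: \<mu>_def val_def wire_of_gad_wire[OF that(2,3)])

  define iq sq where "iq q = q div (l + 1)" and "sq q = q mod (l + 1)" for q
  define Q where "Q = R * (l + 1)"
  \<comment> \<open>Only \<open>n + 1\<close> of the \<open>length (outs C)\<close> target bits are
    prescribed. The rest are set to \<open>False\<close>: the additional output literals only weaken
    \<open>D'\<close>.\<close>
  define bs' where "bs' = map (\<lambda>q. map (\<lambda>o'. o' \<le> n \<and> \<beta> (iq q) (sq q) o') [0..<length (outs C)]) [0..<Q]"
  define \<nu>' where "\<nu>' q p = \<mu> (iq q) (sq q) (l + emb p)" for q p
  define D' where "D' = Disj (map (\<lambda>q. tau C (bs' ! q) (\<nu>' q)) [0..<length bs'])"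
  have Q: "length bs' = Q" by (simp add: bs'_def)
  have iq: "iq q < R" "sq q \<le> l" if "q < Q" for q
    using that by (auto simp: iq_def sq_def Q_def less_mult_imp_div_less Suc_le_eq simp flip: less_Suc_eq_le)
  have q_eq: "q = iq q * (l + 1) + sq q" for q
    unfolding iq_def sq_def by (rule div_mult_mod_eq[symmetric])
  have emb: "emb p < k + 1 + t" if "p < wires C" for p
    using emb_less[of p N] that fits by (simp add: wires_def ins_C)

  have D'_in: "D' \<in> tau_disjunctions C"
  proof -
    have "inj_on (\<lambda>(q, p). \<nu>' q p) ({..<length bs'} \<times> {..<wires C})"
    proof (intro inj_onI)
      fix x y assume x: "x \<in> {..<length bs'} \<times> {..<wires C}" and y: "y \<in> {..<length bs'} \<times> {..<wires C}"
        and eq: "(case x of (q, p) \<Rightarrow> \<nu>' q p) = (case y of (q, p) \<Rightarrow> \<nu>' q p)"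
      obtain q p q' p' where xy: "x = (q, p)" "y = (q', p')" by (cases x; cases y)
      have q: "q < Q" "q' < Q" "p < wires C" "p' < wires C" using x y xy Q by auto
      have "(iq q, gad_wire l k F (sq q) (l + emb p)) = (iq q', gad_wire l k F (sq q') (l + emb p'))"
        using eq iq q emb gad_wire_bounds(2) unfolding xy \<nu>'_def \<mu>_def R_def
        by (intro inj_onD[OF inj]) auto
      moreover from this have "(sq q, emb p) = (sq q', emb p')"
        using wire_of_gad_wire[OF iq(2) emb] q by (metis prod.inject)
      ultimately have "iq q = iq q'" "sq q = sq q'" "p = p'" using inj_emb by (auto dest: injD)
      then show "x = y" using xy q_eq by metis
    qed
    moreover have "bs' \<noteq> []" using bs(1) by (auto simp: bs'_def Q_def R_def)
    moreover have "\<forall>b\<in>set bs'. length b = length (outs C)" by (auto simp: bs'_def)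
    ultimately show ?thesis unfolding tau_disjunctions_def D'_def by blast
  qed

  have R_le: "R \<le> len D"
    using length_le_len_Disj[of "map (\<lambda>i. tau G (bs ! i) (\<nu> i)) [0..<length bs]"] unfolding D R_def by simp

  have len_D': "len D' \<le> (len D * (l + 1) * (8 * csize C + 4) + 1) * len D"
  proof -
    have "len (Atom x) \<le> len D" if x: "x \<in> atoms D'" for x
    proof -
      obtain q where q: "q < Q" "x \<in> atoms (tau C (bs' ! q) (\<nu>' q))"
        using x Q by (auto simp: D'_def)
      have "atoms (tau C (bs' ! q) (\<nu>' q)) \<subseteq> \<nu>' q ` {..<wires C}"
      proof -
        have at: "atoms (gates C ! j) \<subseteq> {..<wires C}" if "j < N" for j
          using wf that by (force simp: wf_circuit_def wires_def)
        have out: "outs C ! i < wires C" if "i < length (outs C)" for i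
          using wf nth_mem[OF that] unfolding wf_circuit_def by blast
        show ?thesis unfolding tau_def using at out by (fastforce simp: Iff_def atoms_rename wires_def)
      qed
      then obtain p where p: "p < wires C" "x = \<nu>' q p" using q by auto
      have "x \<in> atoms (tau G (bs ! iq q) (\<nu> (iq q)))"
        unfolding p(2) \<nu>'_def \<mu>_def by (rule atom_in_tau_G[OF iq(2)[OF q(1)] emb[OF p(1)]])
      then have "x \<in> atoms D" using iq(1)[OF q(1)] by (auto simp: D R_def)
      then show ?thesis by (rule len_atom_le)
    qed
    then have "len D' \<le> fsize D' * len D" using len_ge_4 by (rule len_le_fsize)
    also have "fsize D' \<le> len D * (l + 1) * (8 * csize C + 4) + 1"
    proof -
      have "fsize D' \<le> sum_list (map (\<lambda>q. fsize (tau C (bs' ! q) (\<nu>' q)) + 1) [0..<Q]) + 1"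
        using fsize_Disj[of "map (\<lambda>q. tau C (bs' ! q) (\<nu>' q)) [0..<length bs']"] Q
        by (simp add: D'_def comp_def)
      also have "sum_list (map (\<lambda>q. fsize (tau C (bs' ! q) (\<nu>' q)) + 1) [0..<Q])
          \<le> sum_list (map (\<lambda>q. 8 * csize C + 4) [0..<Q])"
      proof (rule sum_list_mono)
        show "fsize (tau C (bs' ! q) (\<nu>' q)) + 1 \<le> 8 * csize C + 4" for q
          using fsize_tau[of C "bs' ! q" "\<nu>' q"] by simp
      qed
      also have "\<dots> = Q * (8 * csize C + 4)" by (simp add: sum_list_triv)
      also have "\<dots> \<le> len D * (l + 1) * (8 * csize C + 4)"
        unfolding Q_def using R_le by (intro mult_le_mono1)
      finally show ?thesis by simp
    qed
    finally show ?thesis by simp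
  qed

  have "pr (10000 * schema_const * B ^ 4) (Imp (subst_const r D) D')" if B: "len D + len D' + 9 \<le> B" for B
  proof -
    define As Ls where "As q = map (\<lambda>j. Iff (Atom (\<nu>' q (ins C + j))) (rename (\<nu>' q) (gates C ! j))) [0..<N]"
      and "Ls q = map (\<lambda>i. lit (\<nu>' q (outs C ! i)) (\<not> bs' ! q ! i)) [0..<length (outs C)]" for q
    define Es Ms where "Es i = map (\<lambda>j. subst_const r (Iff (Atom (\<nu> i (ins G + j))) (rename (\<nu> i) (gates G ! j)))) [0..<length (gates G)]"
      and "Ms i = map (\<lambda>j. subst_const r (lit (\<nu> i (outs G ! j)) (\<not> bs ! i ! j))) [0..<length (outs G)]" for i
    have D'_eq: "D' = Disj (map (\<lambda>q. Imp (Conj (As q)) (Disj (Ls q))) [0..<Q])"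
      by (simp add: D'_def tau_def Q As_def Ls_def)
    have D_eq: "subst_const r D = Disj (map (\<lambda>i. Imp (Conj (Es i)) (Disj (Ms i))) [0..<R])"
      by (simp add: D tau_def R_def Es_def Ms_def comp_def)
    have lenT: "len (subst_const r D) \<le> len D" by (rule len_subst_const)
    have Imp_len: "len (Imp (Conj (Es i)) (Disj (Ms i))) \<le> len D" if "i < R" for i
      using len_Disj[of "Imp (Conj (Es i)) (Disj (Ms i))" "map (\<lambda>i. Imp (Conj (Es i)) (Disj (Ms i))) [0..<R]"]
        that lenT unfolding D_eq by auto
    have Imp_len': "len (Imp (Conj (As q)) (Disj (Ls q))) \<le> len D'" if "q < Q" for q
      using len_Disj[of "Imp (Conj (As q)) (Disj (Ls q))" "map (\<lambda>q. Imp (Conj (As q)) (Disj (Ls q))) [0..<Q]"]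
        that unfolding D'_eq by auto
    show ?thesis
      unfolding D'_eq D_eq
    proof (rule pr_reduction)
      fix i E assume i: "i < R" and E: "E \<in> set (Es i)"
      then obtain x where x: "x < (l + 1) * (t + 1)"
        "E = subst_const r (Iff (Atom (\<nu> i (ins G + x))) (rename (\<nu> i) (gates G ! x)))"
        unfolding Es_def length_gates_G set_map set_upt by (meson imageE atLeastLessThan_iff)
      from x(1) obtain s j where s: "s \<le> l" "j < t + 1" "x = s * (t + 1) + j" by (rule split_index)
      have E_eq: "E = subst_const r (Iff (Atom (\<mu> i s (l + k + j))) (rename (\<mu> i s) (gates F ! j)))"
      proof -
        have "rename (\<nu> i) (rename f p) = rename (\<lambda>x. \<nu> i (f x)) p" for f p
          by (induction p) auto
        then show ?thesis unfolding x(2) s(3) gate_G[OF s(1,2)] \<mu>_def by simp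
      qed
      define q where "q = i * (l + 1) + s"
      have q: "q < Q" "iq q = i" "sq q = s"
      proof -
        have "i * (l + 1) + s < (i + 1) * (l + 1)" using s(1) by simp
        also have "\<dots> \<le> R * (l + 1)" using i by (intro mult_le_mono1) simp
        finally show "q < Q" unfolding q_def Q_def .
        have "s < l + 1" using s(1) by simp
        then show "iq q = i" "sq q = s" unfolding q_def iq_def sq_def
          by (simp_all del: add_Suc_right mult_Suc_right)
      qed
      have \<nu>'_q: "\<nu>' q = (\<lambda>p. \<mu> i s (l + emb p))" by (simp add: fun_eq_iff \<nu>'_def q)
      have r_u': "r (\<mu> i s (l + p)) = wire_value (\<beta> i s) p" if "p < k + 1 + t" for p
        by (rule r_u[OF i s(1) that])
      obtain H where H: "H = Const True \<or> (\<exists>j<N. H = Iff (Atom (\<nu>' q (n + j))) (rename (\<nu>' q) (gates C ! j))) \<or>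
          (\<exists>o'\<le>n. H = Neg (lit (\<nu>' q (outs C ! o')) (\<not> \<beta> i s o')))"
        and HE: "\<And>B. len (Imp H E) \<le> B \<Longrightarrow> pr (1000 * schema_const * B\<^sup>2) (Imp H E)"
        using local_implication[of r "\<mu> i s" "\<beta> i s" j, OF r_v[OF i] r_u' s(2)]
        unfolding \<nu>'_q E_eq by blast
      have H': "H = Const True \<or> H \<in> set (As q) \<or> H \<in> Neg ` set (Ls q)"
      proof -
        have "Neg (lit (\<nu>' q (outs C ! o')) (\<not> \<beta> i s o')) \<in> Neg ` set (Ls q)" if "o' \<le> n" for o'
        proof -
          have "bs' ! q ! o' = \<beta> i s o'" using that outs_C q by (simp add: bs'_def)
          moreover have "o' \<in> set [0..<length (outs C)]" using that outs_C by simp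
          ultimately have "lit (\<nu>' q (outs C ! o')) (\<not> \<beta> i s o') \<in> set (Ls q)"
            unfolding Ls_def set_map by (intro image_eqI[where x = o']) simp_all
          then show ?thesis by (rule imageI)
        qed
        then show ?thesis using H by (auto simp: As_def ins_C)
      qed
      \<comment> \<open>The connectives \<open>Imp\<close> and \<open>Neg\<close> cost three bits
        each, which the summand 9 in the bound for \<open>B\<close> covers.\<close>
      have "len (Imp H E) \<le> B"
      proof -
        have "len E \<le> len D" using len_Conj[OF E] Imp_len[OF i] by simp
        moreover have "len H \<le> len D' + 3"
          using H'
        proof (elim disjE)
          assume "H = Const True"
          then show ?thesis using len_ge_4[of D'] by simp
        next
          assume "H \<in> set (As q)"
          from len_Conj[OF this] show ?thesis using Imp_len'[OF q(1)] by simp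
        next
          assume "H \<in> Neg ` set (Ls q)"
          then obtain h where "h \<in> set (Ls q)" "H = Neg h" by auto
          with len_Disj[OF this(1)] show ?thesis using Imp_len'[OF q(1)] by simp
        qed
        ultimately show ?thesis using B by simp
      qed
      with H' q(1) HE show "\<exists>H. pr (1000 * schema_const * B\<^sup>2) (Imp H E) \<and>
          (H = Const True \<or> (\<exists>q<Q. H \<in> set (As q) \<or> H \<in> Neg ` set (Ls q)))"
        by blast
    next
      fix i assume i: "i < R"
      show "pr (1000 * schema_const * B\<^sup>2) (Neg (Disj (Ms i)))"
      \<comment> \<open>Every output wire of \<open>G\<close> now carries its own target bit, so
        each output literal is a false constant expression and no case distinction is
        needed.\<close>
      proof (rule pr_local[of "{}"])
        have "keval (\<lambda>x. None) p = Some False" if p: "p \<in> set (Ms i)" for p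
        proof -
          obtain y where y: "y < (l + 1) * (k + 1)"
            "p = subst_const r (lit (\<nu> i (outs G ! y)) (\<not> bs ! i ! y))"
            using p unfolding Ms_def outs_G(1) set_map set_upt by (meson imageE atLeastLessThan_iff)
          from y(1) obtain s o' where s: "s \<le> l" "o' < k + 1" "y = s * (k + 1) + o'" by (rule split_index)
          have "outs G ! y = gad_wire l k F s (l + (t + o'))" using outs_G(2)[of s o'] s by simp
          then have "r (\<nu> i (outs G ! y)) = wire_value (\<beta> i s) (t + o')"
            using r_u[OF i s(1), of "t + o'"] s(2) by (simp add: \<mu>_def)
          also have "\<dots> = Some (bs ! i ! y)"
            using fits n_le s by (simp add: wire_value_def \<beta>_def)
          finally show ?thesis unfolding y(2) by (simp add: lit_def)
        qed
        then have "keval (\<lambda>x. None) (Disj (Ms i)) = Some False" by (rule keval_Disj_False)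
        then show "keval (\<lambda>x. if x \<in> {} then Some (e x) else None) (Neg (Disj (Ms i))) = Some True" for e
          by simp
        show "len (Neg (Disj (Ms i))) \<le> B" using Imp_len[OF i] B by simp
      qed auto
    next
      show "len (Disj (map (\<lambda>q. Imp (Conj (As q)) (Disj (Ls q))) [0..<Q])) + 3 \<le> B"
        using B unfolding D'_eq[symmetric] by simp
      show "len (Disj (map (\<lambda>i. Imp (Conj (Es i)) (Disj (Ms i))) [0..<R])) \<le> B"
        using B lenT unfolding D_eq[symmetric] by simp
    qed
  qed
  with D'_in len_D' show ?thesis by blast
qed

end

section \<open>Polynomial bounds\<close>

lemma frege_axiom_sound: "frege_axiom p \<Longrightarrow> taut p"
  by (induction rule: frege_axiom.induct) (auto simp: taut_def)

lemma pr_sound: "pr s p \<Longrightarrow> taut p"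
  by (induction rule: pr.induct) (auto simp: taut_def dest: frege_axiom_sound)

lemma min_size_le: "P x (enc p) \<Longrightarrow> min_size P p \<le> enat (length x)"
  unfolding min_size_def by (intro INF_lower) simp

lemma min_size_attained:
  assumes "min_size P p \<le> enat s"
  shows "\<exists>x. P x (enc p) \<and> length x \<le> s"
proof -
  let ?S = "(\<lambda>x. enat (length x)) ` {x. P x (enc p)}"
  have "?S \<noteq> {}"
  proof
    assume "?S = {}"
    then have "min_size P p = \<infinity>" unfolding min_size_def by (simp only: Inf_enat_def simp_thms if_True)
    then show False using assms by simp
  qed
  then obtain z where "z \<in> ?S" by blast
  then have "Inf ?S \<in> ?S" by (rule wellorder_InfI)
  then obtain x where "P x (enc p)" "Inf ?S = enat (length x)" by blast
  then show ?thesis using assms unfolding min_size_def by auto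
qed

text \<open>The exponents record the steps: substitution costs the inner \<open>c\<close>,
  simulation of \<open>EF\<close> costs \<open>e\<close>, modus ponens costs the outer
  \<open>c\<close>. The \<open>u + 1\<close> includes the end marker of the \<open>EF\<close>
  proof.\<close>

lemma min_size_reduction:
  assumes sim: "\<And>p. taut p \<Longrightarrow> min_size P p \<le> min_size EF p ^ e"
    and subst: "\<And>\<sigma> r. taut \<sigma> \<Longrightarrow> min_size P (subst_const r \<sigma>) \<le> min_size P \<sigma> ^ c"
    and mp: "\<And>\<alpha> \<beta>. min_size P \<beta> \<le> (min_size P \<alpha> + min_size P (Imp \<alpha> \<beta>)) ^ c"
    and D: "taut D" "min_size P D \<le> enat s"
    and pr: "pr u (Imp (subst_const r D) D')"
  shows "min_size P D' \<le> enat ((s ^ c + (u + 1) ^ e) ^ c)"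
proof -
  have power: "a ^ i \<le> enat (b ^ i)" if "a \<le> enat b" for a b i
    by (induction i) (auto simp: one_enat_def intro: mult_mono[OF that] simp flip: times_enat_simps(1))
  have "min_size P (subst_const r D) \<le> enat (s ^ c)"
    using subst[OF D(1)] power[OF D(2)] by (rule order_trans)
  moreover have "min_size P (Imp (subst_const r D) D') \<le> enat ((u + 1) ^ e)"
  proof -
    obtain x where "EF x (enc (Imp (subst_const r D) D'))" "length x \<le> u + 1"
      using pr_imp_EF[OF pr] by blast
    then have "min_size EF (Imp (subst_const r D) D') \<le> enat (u + 1)"
      by (meson enat_ord_simps(1) min_size_le order_trans)
    with sim[OF pr_sound[OF pr]] power show ?thesis by (meson order_trans)
  qed
  ultimately have "min_size P (subst_const r D) + min_size P (Imp (subst_const r D) D')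
      \<le> enat (s ^ c + (u + 1) ^ e)"
    by (simp add: add_mono flip: plus_enat_simps(1))
  then show ?thesis using mp[of D' "subst_const r D"] power by (meson order_trans)
qed

section \<open>Size of the gadget circuit\<close>

lemma fsize_selected: "fsize (selected a pos w N) \<le> 1 + N * (3 * w + 4)"
proof -
  have "fsize (Conj (map (\<lambda>t. lit (pos + t) (bit i t)) [0..<w])) \<le> 3 * w + 1" for i :: nat
  proof -
    have "sum_list (map (\<lambda>t. fsize (lit (pos + t) (bit i t)) + 1) [0..<w]) \<le> sum_list (map (\<lambda>t. 3) [0..<w])"
      by (rule sum_list_mono) (simp add: lit_def)
    then show ?thesis
      using fsize_Conj[of "map (\<lambda>t. lit (pos + t) (bit i t)) [0..<w]"]
      by (simp add: comp_def sum_list_triv)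
  qed
  then have "sum_list (map (\<lambda>i. fsize (And (Conj (map (\<lambda>t. lit (pos + t) (bit i t)) [0..<w])) (Atom (a + i))) + 1) [0..<N])
      \<le> sum_list (map (\<lambda>i. 3 * w + 4) [0..<N])"
    by (intro sum_list_mono) simp
  then show ?thesis
    using fsize_Disj[of "map (\<lambda>i. And (Conj (map (\<lambda>t. lit (pos + t) (bit i t)) [0..<w])) (Atom (a + i))) [0..<N]"]
    unfolding selected_def by (simp add: comp_def sum_list_triv)
qed

lemma csize_gad_cv_circuit:
  fixes k :: nat
  assumes "1 \<le> k"
  defines "M \<equiv> k\<^sup>2 + k * (k\<^sup>2 + 1) + 1"
  shows "csize (gad_circuit (k\<^sup>2) k (cv_circuit (k\<^sup>2) k)) \<le> M ^ 8"
proof -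
  let ?l = "k\<^sup>2"
  let ?F = "cv_circuit ?l k" and ?t = "cv_gates ?l k" and ?w = "cv_width ?l k"
  define x y where "x = k\<^sup>2" and "y = k * (k\<^sup>2 + 1)"
  have "1 \<le> x" using assms by (simp add: x_def)
  moreover have "k * 2 \<le> y" unfolding y_def using \<open>1 \<le> x\<close> by (intro mult_le_mono2) (simp add: x_def)
  moreover have M_eq: "M = x + y + 1" by (simp add: M_def x_def y_def)
  ultimately have M: "4 \<le> M" "?l + 1 \<le> M" "k + 1 + ?l \<le> M"
    using assms(1) unfolding x_def[symmetric] by linarith+
  have w: "?w \<le> M"
  proof -
    have "?w \<le> k + ?l" unfolding cv_width_def using assms less_exp[of "k + ?l"] by (intro floorlog_leI) auto
    then show ?thesis using M by simp
  qed
  have t: "?t \<le> ?l" unfolding cv_gates_def by simp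
  have sel: "fsize (selected ?l pos ?w (k + 1 + j)) \<le> 5 * M\<^sup>2" if "j < ?t" for pos j
  proof -
    have "fsize (selected ?l pos ?w (k + 1 + j)) \<le> 1 + (k + 1 + j) * (3 * ?w + 4)" by (rule fsize_selected)
    also have "\<dots> \<le> 1 + M * (3 * M + 4)"
      using that t M w by (intro add_mono mult_le_mono) auto
    also have "\<dots> = 3 * M\<^sup>2 + (4 * M + 1)" by (simp add: power2_eq_square algebra_simps)
    also have "4 * M + 1 \<le> 2 * M\<^sup>2"
    proof -
      have "4 * M \<le> M * M" using M by (intro mult_le_mono1)
      then show ?thesis using M unfolding power2_eq_square by linarith
    qed
    finally show ?thesis by simp
  qed
  have gate: "fsize (cv_gate ?l k j) \<le> 27 * M\<^sup>2" if "j < ?t" for j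
  proof -
    have "16 \<le> M\<^sup>2" using power_mono[OF M(1), of 2] by simp
    then show ?thesis
      using sel[OF that, of "j * cv_block ?l k + 2"] sel[OF that, of "j * cv_block ?l k + 2 + ?w"]
      unfolding cv_gate_def Let_def fsize.simps by linarith
  qed
  have F: "sum_list (map fsize (gates ?F)) \<le> 28 * M ^ 3"
  proof -
    have "sum_list (map (\<lambda>j. fsize (cv_gate ?l k j)) [0..<?t]) \<le> sum_list (map (\<lambda>j. 27 * M\<^sup>2) [0..<?t])"
      using gate by (intro sum_list_mono) simp
    also have "\<dots> = ?t * (27 * M\<^sup>2)" by (simp add: sum_list_triv)
    also have "\<dots> \<le> M * (27 * M\<^sup>2)" using t M by (intro mult_le_mono1) simp
    also have "\<dots> = 27 * M ^ 3" by (simp add: power2_eq_square power3_eq_cube)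
    finally have "sum_list (map fsize (gates ?F)) \<le> 1 + 27 * M ^ 3"
      by (simp add: cv_circuit_def comp_def)
    moreover have "1 \<le> M ^ 3" using M by simp
    ultimately show ?thesis by linarith
  qed
  have G: "sum_list (map fsize (gates (gad_circuit ?l k ?F))) = (?l + 1) * sum_list (map fsize (gates ?F))"
  proof -
    have "sum_list (map fsize (concat (map (\<lambda>s. map (rename (f s)) ps) [0..<L]))) = L * sum_list (map fsize ps)"
      for f :: "nat \<Rightarrow> nat \<Rightarrow> nat" and ps L
      by (induction L) (simp_all add: comp_def)
    then show ?thesis unfolding gad_circuit_def circuit.sel .
  qed
  have "csize (gad_circuit ?l k ?F) \<le> M + 28 * M ^ 4 + M"
  proof -
    have "(?l + 1) * sum_list (map fsize (gates ?F)) \<le> M * (28 * M ^ 3)"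
      using M F by (intro mult_le_mono)
    moreover have "M * (28 * M ^ 3) = 28 * M ^ 4" by (simp add: power3_eq_cube power4_eq_xxxx)
    moreover have "ins (gad_circuit ?l k ?F) \<le> M" by (simp add: gad_circuit_def M_def)
    moreover have "length (outs (gad_circuit ?l k ?F)) = M"
      using computes_gad_cv_circuit[of k] by (simp add: computes_def M_def)
    ultimately show ?thesis unfolding csize_def G by linarith
  qed
  also have "\<dots> \<le> 30 * M ^ 4" using M self_le_power[of M 4] by simp
  \<comment> \<open>Raising the exponent absorbs the constant for every \<open>k \<ge> 1\<close>,
    since already at \<open>k = 1\<close> one has \<open>M = 4\<close> and
    \<open>4 ^ 4 = 256\<close>.\<close>
  also have "\<dots> \<le> M ^ 4 * M ^ 4"
    using power_mono[OF M(1), of 4] by (intro mult_le_mono1) simp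
  also have "\<dots> = M ^ 8" by (simp flip: power_add)
  finally show ?thesis .
qed

lemma generator_gad_cv:
  "generator (\<lambda>k. k\<^sup>2 + k * (k\<^sup>2 + 1)) (\<lambda>k. k\<^sup>2 + k * (k\<^sup>2 + 1) + 1)
     (\<lambda>k. Gad (k\<^sup>2) k (CV (k\<^sup>2) k)) (\<lambda>k. gad_circuit (k\<^sup>2) k (cv_circuit (k\<^sup>2) k))"
  unfolding generator_def
  using computes_gad_cv_circuit csize_gad_cv_circuit by (auto intro!: exI[of _ 8])

section \<open>Arithmetic behind the choice of parameters\<close>

lemma square_less_power_2: "20 \<le> s \<Longrightarrow> (8 * s + 16)\<^sup>2 < 2 ^ s" for s :: nat
proof (induction s rule: nat_induct_at_least)
  case base
  show ?case by simp
next
  case (Suc s)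
  have "(8 * Suc s + 16)\<^sup>2 \<le> 2 * (8 * s + 16)\<^sup>2"
    using Suc.hyps by (simp add: power2_eq_square algebra_simps) 
  with Suc.IH show ?case by simp
qed

text \<open>Pointers have logarithmic width, so for large \<open>k\<close> a block takes at most
  \<open>k / 4\<close> bits and \<open>k\<^sup>2\<close> bits describe at least \<open>4 * k\<close>
  gates. The number needed is \<open>2 * k\<close> for \<open>C n\<close> and \<open>k + 1\<close>
  for the outputs; 168 is \<open>8 * 21\<close>, which makes \<open>s \<ge> 20\<close>.\<close>

lemma cv_gates_large:
  assumes "168 \<le> k"
  shows "3 * k + 1 \<le> cv_gates (k\<^sup>2) k"
proof -
  define s where "s = k div 8 - 1"
  have s: "20 \<le> s" "8 * (s + 1) \<le> k" "k \<le> 8 * s + 15" using assms unfolding s_def by presburger+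
  have "k + k\<^sup>2 \<le> (8 * s + 16)\<^sup>2"
  proof -
    have "k + k\<^sup>2 \<le> (k + 1)\<^sup>2" by (simp add: power2_eq_square)
    also have "\<dots> \<le> (8 * s + 16)\<^sup>2" using s by (intro power_mono) auto
    finally show ?thesis .
  qed
  also have "\<dots> < 2 ^ s" using s by (intro square_less_power_2)
  finally have "cv_width (k\<^sup>2) k \<le> s" unfolding cv_width_def using assms by (intro floorlog_leI) auto
  then have b: "4 * cv_block (k\<^sup>2) k \<le> k" using s by (simp add: cv_block_def)
  have "(3 * k + 1) * cv_block (k\<^sup>2) k \<le> k * (4 * cv_block (k\<^sup>2) k)"
    using assms by simp
  also have "\<dots> \<le> k * k" using b by (intro mult_le_mono2)
  finally have "(3 * k + 1) * cv_block (k\<^sup>2) k \<le> k\<^sup>2" by (simp add: power2_eq_square)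
  then show ?thesis unfolding cv_gates_def
    by (metis cv_block_def add_gr_0 div_le_mono nonzero_mult_div_cancel_right not_gr_zero zero_less_numeral)
qed

text \<open>The lower bound on \<open>k\<close> is used to fit \<open>C n\<close> into the
  description, the upper bound to express sizes in terms of \<open>n\<close>.\<close>

lemma integer_root:
  fixes k e :: nat
  assumes "1 \<le> k"
  obtains n where "1 \<le> n" "n ^ (e + 1) \<le> k" "k < (n + 1) ^ (e + 1)"
proof -
  have "k < (k + 1) ^ (e + 1)" using self_le_power[of "k + 1" "e + 1"] by simp
  then obtain n where n: "\<forall>i\<le>n. \<not> k < i ^ (e + 1)" "k < Suc n ^ (e + 1)"
    using ex_least_nat_less[of "\<lambda>x. k < x ^ (e + 1)" "k + 1"] by auto
  moreover have "n \<noteq> 0" using n(2) assms by (auto intro!: Nat.gr0I)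
  ultimately show ?thesis by (intro that[of n]) (auto simp: not_less)
qed

text \<open>Every output contributes a literal. A bound on the lengths of finitely many easy
  disjunctions therefore bounds \<open>m n\<close>.\<close>

lemma len_tau_disjunction:
  assumes "D \<in> tau_disjunctions C"
  shows "length (outs C) \<le> len D"
proof -
  obtain bs \<nu> where D: "D = Disj (map (\<lambda>i. tau C (bs ! i) (\<nu> i)) [0..<length bs])" "bs \<noteq> []"
    using assms unfolding tau_disjunctions_def by blast
  have "length (outs C) \<le> len (tau C (bs ! 0) (\<nu> 0))"
    using length_le_len_Disj[of "map (\<lambda>i. lit (\<nu> 0 (outs C ! i)) (\<not> bs ! 0 ! i)) [0..<length (outs C)]"]
    unfolding tau_def by simp
  also have "\<dots> \<le> len D" unfolding D(1) using D(2) by (intro len_Disj) auto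
  finally show ?thesis .
qed

text \<open>The numbers \<open>y\<close> and \<open>z\<close> are the code lengths of the old and
  the new disjunction. Since \<open>M\<close> exceeds every numerical constant involved, each
  constant costs one more factor \<open>M\<close>, and the resulting exponent is independent of
  \<open>k\<close>.\<close>

lemma size_bound:
  fixes M d c c1 e u y z B :: nat
  assumes M: "9 \<le> M" "10000 * schema_const + 1 \<le> M"
    and y: "y \<le> M ^ (c1 * d) + M" and z: "z \<le> (y * M * M + 1) * y"
    and B: "B = y + z + 9" and y1: "1 \<le> y"
  shows "((M ^ c1) ^ c + (10000 * schema_const * B ^ 4 + 1) ^ e) ^ c \<le>
    M ^ ((c1 * c + (4 * (2 * (c1 * d) + 8) + 1) * e + 1) * c)"
proof -
  define p where "p = c1 * d"
  have mono: "M ^ i \<le> M ^ j" if "i \<le> j" for i j using that M by (intro power_increasing) auto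
  have Msum: "M ^ i + M ^ j \<le> M ^ (h + 1)" if "i \<le> h" "j \<le> h" for i j h
  proof -
    have "M ^ i + M ^ j \<le> 2 * M ^ h" using mono[OF that(1)] mono[OF that(2)] by simp
    also have "\<dots> \<le> M * M ^ h" using M by (intro mult_le_mono1) simp
    finally show ?thesis by simp
  qed
  have y2: "y \<le> M ^ (p + 2)" using y Msum[of p "p + 1" 1] unfolding p_def by simp
  have "1 \<le> y * M * M" using y1 M by simp
  then have "z \<le> (2 * (y * M * M)) * y" by (intro order_trans[OF z] mult_le_mono1) simp
  also have "\<dots> \<le> (M * (M ^ (p + 2) * M * M)) * M ^ (p + 2)"
    using M y2 by (intro mult_le_mono) auto
  also have "\<dots> = M ^ (2 * p + 7)" by (simp add: power_add power2_eq_square eval_nat_numeral algebra_simps)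
  finally have z2: "z \<le> M ^ (2 * p + 7)" .
  have "B \<le> M ^ (2 * p + 7) + M ^ (2 * p + 7) + M ^ (2 * p + 7)"
    using y2 z2 mono[of "p + 2" "2 * p + 7"] mono[of 1 "2 * p + 7"] M unfolding B by simp
  also have "\<dots> = 3 * M ^ (2 * p + 7)" by simp
  also have "\<dots> \<le> M * M ^ (2 * p + 7)" using M by (intro mult_le_mono1) simp
  also have "\<dots> = M ^ Suc (2 * p + 7)" by (rule power_Suc[symmetric])
  also have "Suc (2 * p + 7) = 2 * p + 8" by simp
  finally have B2: "B \<le> M ^ (2 * p + 8)" .
  have "10000 * schema_const * B ^ 4 + 1 \<le> (10000 * schema_const + 1) * B ^ 4" using y1 B by simp
  also have "\<dots> \<le> M * (M ^ (2 * p + 8)) ^ 4" using M B2 by (intro mult_le_mono power_mono) auto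
  also have "\<dots> = M ^ (4 * (2 * p + 8) + 1)" 
    unfolding power_mult[symmetric] by (simp only: mult.commute[of _ 4] Suc_eq_plus1[symmetric] power_Suc)
  finally have "(10000 * schema_const * B ^ 4 + 1) ^ e \<le> M ^ ((4 * (2 * p + 8) + 1) * e)"
    unfolding power_mult by (rule power_mono) simp
  then have "(M ^ c1) ^ c + (10000 * schema_const * B ^ 4 + 1) ^ e \<le> M ^ (c1 * c) + M ^ ((4 * (2 * p + 8) + 1) * e)"
    by (simp add: power_mult)
  also have "\<dots> \<le> M ^ (c1 * c + (4 * (2 * p + 8) + 1) * e + 1)" by (rule Msum) auto
  finally have "((M ^ c1) ^ c + (10000 * schema_const * B ^ 4 + 1) ^ e) ^ c \<le> (M ^ (c1 * c + (4 * (2 * p + 8) + 1) * e + 1)) ^ c"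
    by (rule power_mono) simp
  then show ?thesis unfolding p_def power_mult .
qed

theorem lemma5p7:
  fixes P :: pf_rel and c :: nat
    and m :: "nat \<Rightarrow> nat" and g :: "bool list \<Rightarrow> bool list" and C :: "nat \<Rightarrow> circuit"
  assumes "pps P"
    and "simulates P EF"
    and "1 \<le> c"
    and "\<And>\<sigma> r. taut \<sigma> \<Longrightarrow> min_size P (subst_const r \<sigma>) \<le> min_size P \<sigma> ^ c"
    and "\<And>\<alpha> \<beta>. min_size P \<beta> \<le> (min_size P \<alpha> + min_size P (Imp \<alpha> \<beta>)) ^ c"
    and "or_hard P (\<lambda>n. n) m (\<lambda>n. g) C"
    and "nonuniform_polytime C"
  shows "or_hard P (\<lambda>k. k\<^sup>2 + k * (k\<^sup>2 + 1)) (\<lambda>k. k\<^sup>2 + k * (k\<^sup>2 + 1) + 1)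
           (\<lambda>k. Gad (k\<^sup>2) k (CV (k\<^sup>2) k))
           (\<lambda>k. gad_circuit (k\<^sup>2) k (cv_circuit (k\<^sup>2) k))"
  unfolding or_hard_def
proof (intro conjI allI impI generator_gad_cv)
  fix c1 :: nat
  assume "1 \<le> c1"
  let ?M = "\<lambda>k. k\<^sup>2 + k * (k\<^sup>2 + 1) + 1"
  let ?G = "\<lambda>k. gad_circuit (k\<^sup>2) k (cv_circuit (k\<^sup>2) k)"
  let ?easy = "\<lambda>k D. D \<in> tau_disjunctions (?G k) \<and> (\<exists>x. P x (enc D) \<and> length x \<le> ?M k ^ c1)"
  obtain a where a: "\<And>i p. 1 \<le> i \<Longrightarrow> p \<in> set (gates (C i)) \<Longrightarrow> elementary p"
    "\<And>i. 1 \<le> i \<Longrightarrow> csize (C i) \<le> ins (C i) ^ a + a"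
    using assms(7) unfolding nonuniform_polytime_def by blast
  \<comment> \<open>A short proof forces the proved formula to be short. This bounds the Frege part
    of the argument and, at the end, leaves finitely many formulas for each small
    \<open>k\<close>.\<close>
  obtain d where d: "\<And>x y. P x y \<Longrightarrow> length y \<le> length x ^ d + d"
    using assms(1) unfolding pps_def by blast
  obtain e where e: "\<And>p. taut p \<Longrightarrow> min_size P p \<le> min_size EF p ^ e"
    using assms(2) unfolding simulates_def by blast
  have sound: "taut p" if "P x (enc p)" for x p
    using assms(1) that injD[OF inj_enc] unfolding pps_def by blast
  have C: "n < m n" "computes (C n) n (m n) g" if "1 \<le> n" for n
    using assms(6) that unfolding or_hard_def generator_def by auto
  define K where "K = (c1 * c + (4 * (2 * (c1 * d) + 8) + 1) * e + 1) * c"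
  \<comment> \<open>New proofs have size at most \<open>M ^ K\<close>; the factor 5 comes from
    \<open>M \<le> k ^ 5\<close>, and \<open>a + 1\<close> from
    \<open>k \<le> m n ^ (a + 1)\<close>.\<close>
  define c2 where "c2 = 5 * (a + 1) * K"
  have "1 \<le> c2" using assms(3) by (simp add: c2_def K_def)
  define S where "S = {D. \<exists>i\<ge>1. D \<in> tau_disjunctions (C i) \<and> (\<exists>x. P x (enc D) \<and> length x \<le> m i ^ c2)}"
  have "finite S" using assms(6) \<open>1 \<le> c2\<close> unfolding or_hard_def S_def by blast
  then obtain L where L: "\<And>D. D \<in> S \<Longrightarrow> len D \<le> L"
    using finite_imageI[of S len] by (metis finite_nat_set_iff_bounded_le imageI)

  \<comment> \<open>From 168 on, \<open>cv_gates_large\<close> applies; \<open>a\<close>,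
    \<open>d\<close> and the schema constant are to be absorbed by \<open>k\<close>, and the last
    summand will contradict \<open>m n \<le> L\<close>.\<close>
  define k0 where "k0 = 168 + a + d + 10000 * schema_const + (L + 1) ^ (a + 1)"
  have hard: "\<not> ?easy k D" if k: "k0 \<le> k" for k D
  proof
    assume "?easy k D"
    then obtain x where D: "D \<in> tau_disjunctions (?G k)" and x: "P x (enc D)" "length x \<le> ?M k ^ c1"
      by blast
    have k_ge: "168 \<le> k" "a \<le> k" "d \<le> k" "10000 * schema_const + 1 \<le> k" "(L + 1) ^ (a + 1) \<le> k"
      using k unfolding k0_def by auto
    obtain n where n: "1 \<le> n" "n ^ (a + 1) \<le> k" "k < (n + 1) ^ (a + 1)"
      using integer_root[of k a] k_ge by auto
    have "n ^ a \<le> n ^ (a + 1)" "n \<le> n ^ (a + 1)"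
      using n(1) by (auto intro: power_increasing self_le_power)
    from this[THEN order_trans[OF _ n(2)]] have nk: "n ^ a \<le> k" "n \<le> k" .
    have Cn: "wf_circuit (C n)" "ins (C n) = n" "length (outs (C n)) = m n" "n < m n"
      using C[OF n(1)] by (auto simp: computes_def)
    \<comment> \<open>Both summands of \<open>n ^ a + a\<close> are at most \<open>k\<close>: linear
      size is what the \<open>k\<^sup>2\<close> description bits can hold.\<close>
    have csize: "csize (C n) \<le> 2 * k" using a(2)[OF n(1)] nk k_ge Cn by simp
    have "length (gates (C n)) \<le> sum_list (map fsize (gates (C n)))"
      using sum_list_mono[of "gates (C n)" "\<lambda>_. 1" fsize, OF fsize_pos] by (simp add: sum_list_triv)
    then have "length (gates (C n)) + k + 1 \<le> cv_gates (k\<^sup>2) k"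
      using csize cv_gates_large[OF k_ge(1)] by (simp add: csize_def)
    then interpret padded_circuit k n "C n"
      using Cn nk a(1)[OF n(1)] by unfold_locales auto
    obtain r D' where D': "D' \<in> tau_disjunctions (C n)"
      "len D' \<le> (len D * (k\<^sup>2 + 1) * (8 * csize (C n) + 4) + 1) * len D"
      "pr (10000 * schema_const * (len D + len D' + 9) ^ 4) (Imp (subst_const r D) D')"
      using reduction[OF D] by blast

    define M where "M = ?M k"
    have M: "k \<le> M" "k\<^sup>2 + 1 \<le> M" "16 * k + 4 \<le> M" "M \<le> k ^ 5"
    proof -
      have "17 * k \<le> k\<^sup>2" unfolding power2_eq_square using k_ge by (intro mult_le_mono1) simp
      then show "k \<le> M" "k\<^sup>2 + 1 \<le> M" "16 * k + 4 \<le> M" using k_ge by (auto simp: M_def)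
      have "M = k ^ 3 + k\<^sup>2 + k + 1" by (simp add: M_def power2_eq_square power3_eq_cube)
      also have "\<dots> \<le> k ^ 3 + k ^ 3 + k ^ 3 + k ^ 3"
        using k_ge by (intro add_mono power_increasing self_le_power) auto
      also have "\<dots> = 4 * k ^ 3" by simp
      also have "\<dots> \<le> k\<^sup>2 * k ^ 3"
      proof (rule mult_le_mono1)
        show "4 \<le> k\<^sup>2" using power_mono[of 2 k 2] k_ge by simp
      qed
      also have "\<dots> = k ^ 5" by (simp flip: power_add)
      finally show "M \<le> k ^ 5" .
    qed
    have lenD: "len D \<le> M ^ (c1 * d) + M"
    proof -
      have "len D \<le> length x ^ d + d" using d x(1) by blast
      also have "\<dots> \<le> (M ^ c1) ^ d + M"
        using x(2) k_ge M by (intro add_mono power_mono) (auto simp: M_def)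
      finally show ?thesis by (simp add: power_mult)
    qed
    have lenD': "len D' \<le> (len D * M * M + 1) * len D"
    proof -
      have "8 * csize (C n) + 4 \<le> M" using csize M by linarith
      then have "len D * (k\<^sup>2 + 1) * (8 * csize (C n) + 4) \<le> len D * M * M"
        using M by (intro mult_le_mono) auto
      then show ?thesis by (intro order_trans[OF D'(2)] mult_le_mono1) simp
    qed
    have "min_size P D \<le> enat (M ^ c1)"
      by (rule order_trans[OF min_size_le[of P, OF x(1)]]) (use x(2) in \<open>simp add: M_def\<close>)
    from min_size_reduction[OF e assms(4,5) sound[OF x(1)] this D'(3)]
    have "min_size P D' \<le> enat (((M ^ c1) ^ c + (10000 * schema_const * (len D + len D' + 9) ^ 4 + 1) ^ e) ^ c)" .
    then obtain x' where x': "P x' (enc D')"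
      "length x' \<le> ((M ^ c1) ^ c + (10000 * schema_const * (len D + len D' + 9) ^ 4 + 1) ^ e) ^ c"
      using min_size_attained by blast
    note x'(2)
    also have "\<dots> \<le> M ^ K"
      unfolding K_def using k_ge M(1) len_ge_4[of D] lenD lenD' by (intro size_bound) auto
    also have "\<dots> \<le> ((m n) ^ (5 * (a + 1))) ^ K"
    proof (rule power_mono)
      \<comment> \<open>Stretching enters here: \<open>n + 1 \<le> m n\<close> turns the upper bound
        on \<open>k\<close> into a power of \<open>m n\<close>.\<close>
      have "k \<le> (m n) ^ (a + 1)"
        using n(3) power_mono[of "n + 1" "m n" "a + 1"] Cn(4) by simp
      then have "k ^ 5 \<le> ((m n) ^ (a + 1)) ^ 5" by (rule power_mono) simp
      with M(4) show "M \<le> m n ^ (5 * (a + 1))"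
        unfolding power_mult[symmetric] mult.commute[of _ 5] by (rule order_trans)
    qed simp
    also have "\<dots> = m n ^ c2" by (simp add: c2_def power_mult)
    finally have "D' \<in> S" unfolding S_def using D'(1) x'(1) n(1) by blast
    from L[OF this] have "m n \<le> L" using len_tau_disjunction[OF D'(1)] Cn(3) by simp
    then have "(n + 1) ^ (a + 1) \<le> (L + 1) ^ (a + 1)" using Cn(4) by (intro power_mono) auto
    then show False using n(3) k_ge(5) by simp
  qed
  \<comment> \<open>Hardness has been shown only from \<open>k0\<close> on; for each smaller index
    the easy disjunctions have bounded code length and are thus finite in number.\<close>
  have "{D. \<exists>i\<ge>1. ?easy i D} \<subseteq> (\<Union>k<k0. {D. len D \<le> (?M k ^ c1) ^ d + d})"
  proof
    fix D assume "D \<in> {D. \<exists>i\<ge>1. ?easy i D}"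
    then obtain k x where k: "?easy k D" "P x (enc D)" "length x \<le> ?M k ^ c1" by blast
    have "k < k0" using hard k(1) by (meson not_less)
    moreover have "len D \<le> (?M k ^ c1) ^ d + d"
      using d[OF k(2)] power_mono[OF k(3), of d] by simp
    ultimately show "D \<in> (\<Union>k<k0. {D. len D \<le> (?M k ^ c1) ^ d + d})" by blast
  qed
  then show "finite {D. \<exists>i\<ge>1. ?easy i D}"
    by (rule finite_subset) (simp add: finite_len_le)
qed

end
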